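(* Fix a natural number $m$. There is a constant $K$ (depending only on $m$) such that for every $c$ and all sufficiently large $n$ the following holds: if $x_1,\ldots,x_m$ are chosen independently and uniformly at random among binary strings of length $n$, then with probability at least $1-K2^{-c}$ the $m$ statements "$\mathrm{C}(x_1)\ge n-c$", $\ldots$, "$\mathrm{C}(x_m)\ge n-c$" are $\mathsf{PA}$-independent.
   Context: $\mathsf{PA}$ is Peano arithmetic. $\mathrm{C}$ is plain Kolmogorov complexity, represented in $\mathsf{PA}$ as $\mathrm{C}_D(x)=\min\{|p|:D(p)=x\}$ for a provably optimal interpreter $D$ (for every partial computable $D'$ there is $c'$ with $\mathsf{PA}\vdash\forall x\,[\mathrm{C}_D(x)\le\mathrm{C}_{D'}(x)+c']$). Statements $T_1,\ldots,T_m$ are $\mathsf{PA}$-independent if each of the $2^m$ combinations $(\lnot)T_1,\ldots,(\lnot)T_m$ (each statement taken with or without negation) is consistent with $\mathsf{PA}$. *)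

theory Defs
  imports "HOL-Probability.Product_PMF"
begin

section \<open>First-order arithmetic\<close>

text \<open>Terms and formulas of the language \<open>0, S, +, \<times>, =\<close>, with de Bruijn indices.\<close>

datatype trm = Var nat | Zero | Succ trm | Plus trm trm | Times trm trm

datatype fm =
    Eq trm trm (infix "\<^bold>=" 55)
  | Falsum ("\<^bold>\<bottom>")
  | Imp fm fm (infixr "\<^bold>\<longrightarrow>" 51)
  | Forall fm ("\<^bold>\<forall> _" [53] 53)

abbreviation Neg :: "fm \<Rightarrow> fm" ("\<^bold>\<not> _" [53] 53) where
  "\<^bold>\<not> A \<equiv> A \<^bold>\<longrightarrow> \<^bold>\<bottom>"

abbreviation Con :: "fm \<Rightarrow> fm \<Rightarrow> fm" (infixr "\<^bold>\<and>" 52) where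
  "A \<^bold>\<and> B \<equiv> \<^bold>\<not> (A \<^bold>\<longrightarrow> \<^bold>\<not> B)"

abbreviation Exists :: "fm \<Rightarrow> fm" ("\<^bold>\<exists> _" [53] 53) where
  "\<^bold>\<exists> A \<equiv> \<^bold>\<not> (\<^bold>\<forall> (\<^bold>\<not> A))"

text \<open>Simultaneous substitution.\<close>

primrec tsubst :: "(nat \<Rightarrow> trm) \<Rightarrow> trm \<Rightarrow> trm" where
  "tsubst \<sigma> (Var i) = \<sigma> i"
| "tsubst \<sigma> Zero = Zero"
| "tsubst \<sigma> (Succ t) = Succ (tsubst \<sigma> t)"
| "tsubst \<sigma> (Plus t u) = Plus (tsubst \<sigma> t) (tsubst \<sigma> u)"
| "tsubst \<sigma> (Times t u) = Times (tsubst \<sigma> t) (tsubst \<sigma> u)"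

definition up :: "nat \<Rightarrow> trm \<Rightarrow> trm" where
  "up k = tsubst (\<lambda>i. Var (i + k))"

primrec fsubst :: "(nat \<Rightarrow> trm) \<Rightarrow> fm \<Rightarrow> fm" where
  "fsubst \<sigma> (t \<^bold>= u) = (tsubst \<sigma> t \<^bold>= tsubst \<sigma> u)"
| "fsubst \<sigma> \<^bold>\<bottom> = \<^bold>\<bottom>"
| "fsubst \<sigma> (A \<^bold>\<longrightarrow> B) = (fsubst \<sigma> A \<^bold>\<longrightarrow> fsubst \<sigma> B)"
| "fsubst \<sigma> (\<^bold>\<forall> A) = \<^bold>\<forall> (fsubst (case_nat (Var 0) (\<lambda>i. up 1 (\<sigma> i))) A)"

text \<open>\<open>inst t A\<close> is the body \<open>A\<close> of a quantifier with \<open>t\<close> put for the bound variable.\<close>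

definition inst :: "trm \<Rightarrow> fm \<Rightarrow> fm" where
  "inst t = fsubst (case_nat t Var)"

definition flift :: "fm \<Rightarrow> fm" where
  "flift = fsubst (\<lambda>i. Var (Suc i))"

text \<open>
  Hilbert-style derivability in classical first-order logic with equality.
  By rule \<open>Gen\<close>, the members of \<open>T\<close> count as universally closed.
\<close>

inductive provable :: "fm set \<Rightarrow> fm \<Rightarrow> bool" (infix "\<turnstile>" 40) for T :: "fm set" where
  Hyp: "A \<in> T \<Longrightarrow> T \<turnstile> A"
| MP: "T \<turnstile> A \<^bold>\<longrightarrow> B \<Longrightarrow> T \<turnstile> A \<Longrightarrow> T \<turnstile> B"
| Gen: "T \<turnstile> A \<Longrightarrow> T \<turnstile> \<^bold>\<forall> A"
| AxK: "T \<turnstile> A \<^bold>\<longrightarrow> B \<^bold>\<longrightarrow> A"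
| AxS: "T \<turnstile> (A \<^bold>\<longrightarrow> B \<^bold>\<longrightarrow> C) \<^bold>\<longrightarrow> (A \<^bold>\<longrightarrow> B) \<^bold>\<longrightarrow> A \<^bold>\<longrightarrow> C"
| AxDN: "T \<turnstile> \<^bold>\<not> \<^bold>\<not> A \<^bold>\<longrightarrow> A"
| AxInst: "T \<turnstile> \<^bold>\<forall> A \<^bold>\<longrightarrow> inst t A"
| AxDist: "T \<turnstile> \<^bold>\<forall> (A \<^bold>\<longrightarrow> B) \<^bold>\<longrightarrow> \<^bold>\<forall> A \<^bold>\<longrightarrow> \<^bold>\<forall> B"
| AxVac: "T \<turnstile> A \<^bold>\<longrightarrow> \<^bold>\<forall> (flift A)"
| AxRefl: "T \<turnstile> t \<^bold>= t"
| AxLeibniz: "T \<turnstile> t \<^bold>= u \<^bold>\<longrightarrow> inst t A \<^bold>\<longrightarrow> inst u A"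

definition consistent :: "fm set \<Rightarrow> bool" where
  "consistent T \<longleftrightarrow> \<not> T \<turnstile> \<^bold>\<bottom>"

inductive_set PA :: "fm set" where
  "\<^bold>\<not> Succ (Var 0) \<^bold>= Zero \<in> PA"
| "Succ (Var 0) \<^bold>= Succ (Var 1) \<^bold>\<longrightarrow> Var 0 \<^bold>= Var 1 \<in> PA"
| "Plus (Var 0) Zero \<^bold>= Var 0 \<in> PA"
| "Plus (Var 0) (Succ (Var 1)) \<^bold>= Succ (Plus (Var 0) (Var 1)) \<in> PA"
| "Times (Var 0) Zero \<^bold>= Zero \<in> PA"
| "Times (Var 0) (Succ (Var 1)) \<^bold>= Plus (Times (Var 0) (Var 1)) (Var 0) \<in> PA"
| "inst Zero A \<^bold>\<longrightarrow>
     \<^bold>\<forall> (A \<^bold>\<longrightarrow> fsubst (case_nat (Succ (Var 0)) (\<lambda>i. Var (Suc i))) A) \<^bold>\<longrightarrow>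
     \<^bold>\<forall> A \<in> PA"

definition PA_independent :: "nat \<Rightarrow> (nat \<Rightarrow> fm) \<Rightarrow> bool" where
  "PA_independent m T \<longleftrightarrow>
     (\<forall>b :: nat \<Rightarrow> bool. consistent (PA \<union> (\<lambda>i. if b i then T i else \<^bold>\<not> T i) ` {..<m}))"

primrec numeral_trm :: "nat \<Rightarrow> trm" where
  "numeral_trm 0 = Zero"
| "numeral_trm (Suc n) = Succ (numeral_trm n)"

definition le_fm :: "trm \<Rightarrow> trm \<Rightarrow> fm" where
  "le_fm t u = \<^bold>\<exists> (Plus (Var 0) (up 1 t) \<^bold>= up 1 u)"

definition less_fm :: "trm \<Rightarrow> trm \<Rightarrow> fm" where
  "less_fm t u = le_fm (Succ t) u"


section \<open>Partial computable functions in arithmetic\<close>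

text \<open>
  Programs for the partial recursive functions: zero, successor, projections (counted from 0),
  composition, primitive recursion and unbounded search.  A program is applied to a list of
  arguments; there is no arity discipline, missing arguments are read as 0.
\<close>

datatype recf = Zr | Sc | Pj nat | Cn recf "recf list" | Pr recf recf | Mn recf

definition arg :: "trm list \<Rightarrow> nat \<Rightarrow> trm" where
  "arg ts i = (if i < length ts then ts ! i else Zero)"

text \<open>Goedel's beta function: \<open>v = a mod (1 + (i + 1) * b)\<close>.\<close>

definition beta_fm :: "trm \<Rightarrow> trm \<Rightarrow> trm \<Rightarrow> trm \<Rightarrow> fm" where
  "beta_fm a b i v =
     \<^bold>\<exists> (up 1 a \<^bold>= Plus (Times (Var 0) (Succ (Times (Succ (up 1 i)) (up 1 b)))) (up 1 v)) \<^bold>\<and>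
     le_fm v (Times (Succ i) b)"

definition conjs :: "fm list \<Rightarrow> fm" where
  "conjs As = foldr Con As (\<^bold>\<not> \<^bold>\<bottom>)"

definition exs :: "nat \<Rightarrow> fm \<Rightarrow> fm" where
  "exs k = Exists ^^ k"

text \<open>
  \<open>graph f ts y\<close> is the formula \<open>f(ts) = y\<close> (the computation converges with value \<open>y\<close>), in the
  usual formalization of recursive functions in arithmetic:

  \<^item> \<open>Cn f [g\<^sub>0, \<dots>]\<close>: \<open>\<exists>z\<^sub>0 \<dots>. g\<^sub>0(ts) = z\<^sub>0 \<and> \<dots> \<and> f(z\<^sub>0, \<dots>) = y\<close>;

  \<^item> \<open>Pr f g\<close>, with \<open>h(0, xs) = f(xs)\<close> and \<open>h(i+1, xs) = g(i, h(i, xs), xs)\<close>: some \<open>a, b\<close> code under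
    the beta function a sequence that starts with \<open>f(xs)\<close>, is continued by \<open>g\<close>, and has \<open>y\<close> at
    position \<open>n\<close>, where \<open>ts = n # xs\<close>;

  \<^item> \<open>Mn f\<close>: \<open>f(y, ts) = 0\<close> and for every \<open>z < y\<close> the value \<open>f(z, ts)\<close> is defined and a successor.
\<close>

primrec graph :: "recf \<Rightarrow> trm list \<Rightarrow> trm \<Rightarrow> fm" where
  "graph Zr = (\<lambda>ts y. y \<^bold>= Zero)"
| "graph Sc = (\<lambda>ts y. y \<^bold>= Succ (arg ts 0))"
| "graph (Pj i) = (\<lambda>ts y. y \<^bold>= arg ts i)"
| "graph (Cn f gs) = (\<lambda>ts y.
     let k = length gs in
     exs k (conjs (map2 (\<lambda>G i. G (map (up k) ts) (Var i)) (map graph gs) [0..<k]) \<^bold>\<and>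
            graph f (map Var [0..<k]) (up k y)))"
| "graph (Pr f g) = (\<lambda>ts y.
     let n = arg ts 0; xs = tl ts in
     \<^bold>\<exists> \<^bold>\<exists> (\<^bold>\<exists> (beta_fm (Var 2) (Var 1) Zero (Var 0) \<^bold>\<and> graph f (map (up 3) xs) (Var 0)) \<^bold>\<and>
          \<^bold>\<forall> (less_fm (Var 0) (up 3 n) \<^bold>\<longrightarrow>
              \<^bold>\<exists> \<^bold>\<exists> (beta_fm (Var 4) (Var 3) (Var 2) (Var 1) \<^bold>\<and>
                   beta_fm (Var 4) (Var 3) (Succ (Var 2)) (Var 0) \<^bold>\<and>
                   graph g (Var 2 # Var 1 # map (up 5) xs) (Var 0))) \<^bold>\<and>
          beta_fm (Var 1) (Var 0) (up 2 n) (up 2 y)))"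
| "graph (Mn f) = (\<lambda>ts y.
     graph f (y # ts) Zero \<^bold>\<and>
     \<^bold>\<forall> (less_fm (Var 0) (up 1 y) \<^bold>\<longrightarrow>
         \<^bold>\<exists> (graph f (Var 1 # map (up 2) ts) (Succ (Var 0)))))"


section \<open>Kolmogorov complexity in arithmetic\<close>

text \<open>
  Binary strings are identified with all natural numbers via the length-lexicographic order
  (bijective base-2 notation), so that \<open>|p|\<close> is the \<open>k\<close> with \<open>2^k \<le> p + 1 < 2^(k+1)\<close>.
\<close>

definition string_code :: "bool list \<Rightarrow> nat" where
  "string_code w = foldl (\<lambda>n b. 2 * n + (if b then 2 else 1)) 0 w"

definition add_recf :: recf where
  "add_recf = Pr (Pj 0) (Cn Sc [Pj 1])"

definition pow2_recf :: recf where
  "pow2_recf = Pr (Cn Sc [Zr]) (Cn add_recf [Pj 1, Pj 1])"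

definition length_fm :: "trm \<Rightarrow> trm \<Rightarrow> fm" where
  "length_fm p k =
     \<^bold>\<exists> (graph pow2_recf [up 1 k] (Var 0) \<^bold>\<and>
         le_fm (Var 0) (Succ (up 1 p)) \<^bold>\<and>
         less_fm (Succ (up 1 p)) (Plus (Var 0) (Var 0)))"

text \<open>
  \<open>complexity_fm D x v\<close> is \<open>min {|p| : D(p) = x} = v\<close>.  It fails for every \<open>v\<close> if \<open>x\<close> has no
  description; the complexity of \<open>x\<close> is then infinite, in line with the two formulas that follow.
\<close>

definition complexity_fm :: "recf \<Rightarrow> trm \<Rightarrow> trm \<Rightarrow> fm" where
  "complexity_fm D x v =
     \<^bold>\<exists> (graph D [Var 0] (up 1 x) \<^bold>\<and> length_fm (Var 0) (up 1 v)) \<^bold>\<and>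
     \<^bold>\<forall> \<^bold>\<forall> (graph D [Var 1] (up 2 x) \<^bold>\<and> length_fm (Var 1) (Var 0) \<^bold>\<longrightarrow> le_fm (up 2 v) (Var 0))"

definition complexity_ge_fm :: "recf \<Rightarrow> trm \<Rightarrow> trm \<Rightarrow> fm" where
  "complexity_ge_fm D x k = \<^bold>\<forall> (complexity_fm D (up 1 x) (Var 0) \<^bold>\<longrightarrow> le_fm (up 1 k) (Var 0))"

text \<open>\<open>\<forall>x. C_D(x) \<le> C_D'(x) + c\<close>\<close>

definition dominates_fm :: "recf \<Rightarrow> recf \<Rightarrow> nat \<Rightarrow> fm" where
  "dominates_fm D D' c =
     \<^bold>\<forall> \<^bold>\<forall> (complexity_fm D' (Var 1) (Var 0) \<^bold>\<longrightarrow>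
          \<^bold>\<exists> (complexity_fm D (Var 2) (Var 0) \<^bold>\<and> le_fm (Var 0) (Plus (Var 1) (numeral_trm c))))"

definition provably_optimal :: "recf \<Rightarrow> bool" where
  "provably_optimal D \<longleftrightarrow> (\<forall>D'. \<exists>c. PA \<turnstile> dominates_fm D D' c)"

text \<open>The statement \<open>C_D(w) \<ge> k\<close> about a concrete string \<open>w\<close> and number \<open>k\<close>.\<close>

definition complexity_ge :: "recf \<Rightarrow> bool list \<Rightarrow> nat \<Rightarrow> fm" where
  "complexity_ge D w k = complexity_ge_fm D (numeral_trm (string_code w)) (numeral_trm k)"

end

theory Submission
  imports Defs "HOL-Number_Theory.Cong" "HOL-Library.Nat_Bijection" "HOL-Library.Discrete_Functions"
begin

text \<open>
  Fix a sign pattern and suppose that, for a tuple with positively signed part \<open>f\<close> and negatively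
  signed part \<open>g\<close>, inconsistency occurs with probability more than \<open>m 2\<^sup>-\<^sup>c\<close>.  Then it does so for
  some fixed \<open>g\<close> and more than an \<open>m 2\<^sup>-\<^sup>c\<close> fraction of all \<open>f\<close>.  Enumerating the proofs of \<open>PA\<close>, one
  computes such a \<open>g\<close> from \<open>n\<close>, so its components have complexity \<open>O(log n) < n - c\<close>.  On the
  other hand all components of \<open>f\<close> have complexity at least \<open>n - c\<close> except for an \<open>m 2\<^sup>-\<^sup>c\<close> fraction
  of the \<open>f\<close>.  Hence for one of the \<open>f\<close> the standard model satisfies the supposedly inconsistent
  theory.  A union bound over the \<open>2\<^sup>m\<close> patterns gives \<open>K = m 2\<^sup>m\<close>.

  Everything is evaluated in the standard model; of provable optimality only the truth of the
  proved inequalities is used, and no proof inside \<open>PA\<close> is ever constructed.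
\<close>

section \<open>The standard model\<close>

text \<open>The obstacle is that truth does not help for the tuple itself. The components of a
  random tuple are typically incompressible, so a theory with a negated statement about them is
  false in the standard model, although it should be consistent. Building a nonstandard model for it
  is avoided by counting. Inconsistency is semidecidable, so a lower bound on the number of
  inconsistent tuples is confirmed by search whenever it holds, and a successful search compresses
  its own outcome. The program has \<open>D\<close>, \<open>m\<close>, \<open>c\<close> and the sign
  pattern built in and reads only \<open>n\<close>; hence the additive constants of optimality
  depend on all of these, and \<open>n\<close> has to be large compared with them, while
  \<open>K\<close> comes from counting alone. The \<open>g\<close> that the search returns need not
  be the one whose existence makes it succeed: all that matters is that its inconsistent completions
  are frequent. The longest part of the work is to show that provability from a theory with
  parameters is semidecidable; syntax is treated through enumerable relations on codes rather than
  through recursive functions.\<close>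

primrec tval :: "(nat \<Rightarrow> nat) \<Rightarrow> trm \<Rightarrow> nat" where
  "tval e (Var i) = e i"
| "tval e Zero = 0"
| "tval e (Succ t) = Suc (tval e t)"
| "tval e (Plus t u) = tval e t + tval e u"
| "tval e (Times t u) = tval e t * tval e u"

primrec sat :: "(nat \<Rightarrow> nat) \<Rightarrow> fm \<Rightarrow> bool" where
  "sat e (t \<^bold>= u) \<longleftrightarrow> tval e t = tval e u"
| "sat e \<^bold>\<bottom> \<longleftrightarrow> False"
| "sat e (A \<^bold>\<longrightarrow> B) \<longleftrightarrow> (sat e A \<longrightarrow> sat e B)"
| "sat e (\<^bold>\<forall> A) \<longleftrightarrow> (\<forall>x. sat (case_nat x e) A)"

lemma tval_tsubst [simp]: "tval e (tsubst \<sigma> t) = tval (\<lambda>i. tval e (\<sigma> i)) t"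
  by (induction t) auto

lemma tval_up_1 [simp]: "tval (case_nat x e) (up (Suc 0) t) = tval e t"
  by (simp add: up_def)

lemma tval_up: "tval e (up k t) = tval (\<lambda>i. e (i + k)) t"
  by (simp add: up_def)

lemma sat_fsubst [simp]: "sat e (fsubst \<sigma> A) \<longleftrightarrow> sat (\<lambda>i. tval e (\<sigma> i)) A"
proof (induction A arbitrary: e \<sigma>)
  case (Forall A)
  have "(\<lambda>i. tval (case_nat x e) (case_nat (Var 0) (\<lambda>i. up 1 (\<sigma> i)) i)) =
        case_nat x (\<lambda>i. tval e (\<sigma> i))" for x
    by (rule ext) (simp split: nat.split)
  then show ?case by (simp only: fsubst.simps sat.simps Forall.IH)
qed auto

lemma sat_inst [simp]: "sat e (inst t A) \<longleftrightarrow> sat (case_nat (tval e t) e) A"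
proof -
  have "(\<lambda>i. tval e (case_nat t Var i)) = case_nat (tval e t) e"
    by (rule ext) (simp split: nat.split)
  then show ?thesis by (simp add: inst_def)
qed

lemma sat_flift [simp]: "sat e (flift A) \<longleftrightarrow> sat (\<lambda>i. e (Suc i)) A"
  by (simp add: flift_def)

text \<open>The environment stays arbitrary throughout the induction, because \<open>Gen\<close>
  re-reads its premise under every value of the quantified variable; so the members of
  \<open>T\<close> must be true in all environments.\<close>

lemma soundness:
  assumes "T \<turnstile> A" and "\<And>B e. B \<in> T \<Longrightarrow> sat e B"
  shows "sat e A"
  using assms(1) by (induction arbitrary: e) (auto simp: assms(2))

lemma sat_PA: "A \<in> PA \<Longrightarrow> sat e A"
proof (induction rule: PA.induct)
  case (7 A)
  \<comment> \<open>Putting the successor for the bound variable means evaluating at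
    \<open>Suc x\<close>, which turns the axiom scheme into induction on natural numbers.\<close>
  have *: "(\<lambda>i. tval (case_nat x e) (case_nat (Succ (Var 0)) (\<lambda>i. Var (Suc i)) i)) =
        case_nat (Suc x) e" for x
    by (rule ext) (simp split: nat.split)
  show ?case
  proof (simp add: *, intro impI allI)
    fix x
    assume "sat (case_nat 0 e) A"
      and "\<forall>x. sat (case_nat x e) A \<longrightarrow> sat (case_nat (Suc x) e) A"
    then show "sat (case_nat x e) A" by (induction x) auto
  qed
qed auto

lemma sat_theory_consistent:
  assumes "\<And>B e. B \<in> T \<Longrightarrow> sat e B"
  shows "consistent T"
  using soundness[OF _ assms, of T "\<^bold>\<bottom>"] by (auto simp: consistent_def)

lemma tval_numeral [simp]: "tval e (numeral_trm n) = n"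
  by (induction n) auto

lemma sat_le_fm [simp]: "sat e (le_fm t u) \<longleftrightarrow> tval e t \<le> tval e u"
  using le_Suc_ex[of "tval e t" "tval e u"] by (auto simp: le_fm_def intro: add.commute)

lemma sat_less_fm [simp]: "sat e (less_fm t u) \<longleftrightarrow> tval e t < tval e u"
  by (simp add: less_fm_def Suc_le_eq)


section \<open>Goedel's beta function\<close>

definition beta :: "nat \<Rightarrow> nat \<Rightarrow> nat \<Rightarrow> nat" where
  "beta a b i = a mod Suc (Suc i * b)"

lemma sat_beta_fm [simp]:
  "sat e (beta_fm a b i v) \<longleftrightarrow> tval e v = beta (tval e a) (tval e b) (tval e i)"
proof -
  define M where "M = Suc (Suc (tval e i) * tval e b)"
  have "(\<exists>q. tval e a = q * M + tval e v) \<and> tval e v < M \<longleftrightarrow> tval e v = tval e a mod M"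
    by (metis M_def div_mult_mod_eq mod_less mod_less_divisor mod_mult_self3 zero_less_Suc)
  then show ?thesis
    by (simp add: beta_fm_def beta_def M_def less_Suc_eq_le)
qed

text \<open>A common prime of both moduli divides their difference \<open>(j - i) * fact n\<close>,
  hence \<open>fact n\<close> itself because \<open>j - i\<close> is a factor of
  \<open>fact n\<close>; but then it divides 1.\<close>

lemma beta_coprime:
  assumes "i < j" "j < n"
  shows "coprime (Suc (Suc i * fact n)) (Suc (Suc j * fact n))"
proof (rule ccontr)
  assume "\<not> ?thesis"
  then have "gcd (Suc (Suc i * fact n)) (Suc (Suc j * fact n)) \<noteq> 1"
    unfolding coprime_iff_gcd_eq_1 .
  from prime_factor_nat[OF this]
  obtain p where p: "prime p" "p dvd Suc (Suc i * fact n)" "p dvd Suc (Suc j * fact n)"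
    by (auto simp only: gcd_greatest_iff)
  have "Suc (Suc j * fact n) - Suc (Suc i * fact n) = (j - i) * fact n"
    by (simp add: diff_mult_distrib)
  with dvd_diff_nat[OF p(3,2)] have "p dvd (j - i) * fact n"
    by simp
  moreover have "(j - i) dvd fact n"
    using assms by (intro dvd_fact) auto
  ultimately have "p dvd fact n"
    using p(1) by (meson dvd_trans prime_dvd_mult_iff)
  then have "p dvd Suc i * fact n" by simp
  then have "p dvd 1"
    using p(2) by (metis dvd_add_right_iff Suc_eq_plus1)
  then show False using p(1) by simp
qed

lemma beta_complete: "\<exists>a b. \<forall>i<n. beta a b i = s i"
proof -
  \<comment> \<open>\<open>N\<close> has to be at least \<open>n\<close> for the coprimality and at
    least every \<open>s i\<close>, so that each value is below its modulus and survives the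
    reduction.\<close>
  define N where "N = n + (\<Sum>i<n. s i)"
  define M where "M i = Suc (Suc i * fact N)" for i
  have "coprime (M i) (M j)" if "i < n" "j < n" "i \<noteq> j" for i j
    using that beta_coprime[of i j N] beta_coprime[of j i N]
    by (auto simp: M_def N_def coprime_commute neq_iff)
  then have "\<exists>x. \<forall>i\<in>{..<n}. [x = s i] (mod M i)"
    by (intro chinese_remainder_nat) auto
  then obtain a where a: "\<And>i. i < n \<Longrightarrow> [a = s i] (mod M i)" by auto
  have "beta a (fact N) i = s i" if "i < n" for i
  proof -
    have "s i \<le> (\<Sum>i<n. s i)" using that by (intro member_le_sum) auto
    also have "\<dots> \<le> fact N"
      using fact_ge_self[of N] by (simp add: N_def)
    also have "\<dots> \<le> Suc i * fact N" by simp
    finally have "s i < M i" by (simp add: M_def)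
    then show ?thesis
      using a[OF that] unfolding beta_def M_def[symmetric] cong_def by simp
  qed
  then show ?thesis by blast
qed


section \<open>Semantics of the recursive functions\<close>

definition narg :: "nat list \<Rightarrow> nat \<Rightarrow> nat" where
  "narg xs i = (if i < length xs then xs ! i else 0)"

text \<open>A relation, since programs may diverge. The clauses follow those of
  \<open>graph\<close>, with an actual sequence \<open>s\<close> where the formula has a beta
  code.\<close>

primrec reval :: "recf \<Rightarrow> nat list \<Rightarrow> nat \<Rightarrow> bool" where
  "reval Zr = (\<lambda>xs y. y = 0)"
| "reval Sc = (\<lambda>xs y. y = Suc (narg xs 0))"
| "reval (Pj i) = (\<lambda>xs y. y = narg xs i)"
| "reval (Cn f gs) = (\<lambda>xs y. \<exists>zs. list_all2 (\<lambda>G z. G xs z) (map reval gs) zs \<and> reval f zs y)"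
| "reval (Pr f g) = (\<lambda>xs y. \<exists>s. reval f (tl xs) (s 0) \<and>
     (\<forall>i<narg xs 0. reval g (i # s i # tl xs) (s (Suc i))) \<and> y = s (narg xs 0))"
| "reval (Mn f) = (\<lambda>xs y. reval f (y # xs) 0 \<and> (\<forall>z<y. \<exists>v. reval f (z # xs) (Suc v)))"

lemma reval_unique: "reval f xs y \<Longrightarrow> reval f xs y' \<Longrightarrow> y = y'"
proof (induction f arbitrary: xs y y')
  case (Cn f gs)
  obtain zs zs' where zs: "list_all2 (\<lambda>G z. G xs z) (map reval gs) zs" "reval f zs y"
    "list_all2 (\<lambda>G z. G xs z) (map reval gs) zs'" "reval f zs' y'"
    using Cn.prems by auto
  have "zs = zs'"
    using zs(1,3) Cn.IH(2)[OF nth_mem]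
    by (auto simp: list_all2_conv_all_nth intro!: nth_equalityI)
  then show ?case using zs Cn.IH(1) by blast
next
  case (Pr f g)
  obtain s s' where s: "reval f (tl xs) (s 0)" "\<forall>i<narg xs 0. reval g (i # s i # tl xs) (s (Suc i))"
      "y = s (narg xs 0)"
    and s': "reval f (tl xs) (s' 0)" "\<forall>i<narg xs 0. reval g (i # s' i # tl xs) (s' (Suc i))"
      "y' = s' (narg xs 0)"
    using Pr.prems by auto
  have "i \<le> narg xs 0 \<Longrightarrow> s i = s' i" for i
  proof (induction i)
    case 0
    then show ?case using s(1) s'(1) Pr.IH(1) by blast
  next
    case (Suc i)
    then show ?case using s(2) s'(2) Pr.IH(2) by (metis Suc_le_eq less_imp_le)
  qed
  then show ?case using s(3) s'(3) by simp
next
  case (Mn f)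
  \<comment> \<open>Were the two values different, the search ending at the larger one would require
    a successor at the smaller one, where the program returns 0.\<close>
  then show ?case by simp (metis Zero_not_Suc linorder_neqE_nat)
qed auto

lemma tval_arg [simp]: "tval e (arg ts i) = narg (map (tval e) ts) i"
  by (simp add: arg_def narg_def)

lemma sat_conjs [simp]: "sat e (conjs As) \<longleftrightarrow> (\<forall>A\<in>set As. sat e A)"
  by (induction As) (auto simp: conjs_def)

definition ext_env :: "nat list \<Rightarrow> (nat \<Rightarrow> nat) \<Rightarrow> nat \<Rightarrow> nat" where
  "ext_env zs e i = (if i < length zs then zs ! i else e (i - length zs))"

lemma sat_exs: "sat e (exs k A) \<longleftrightarrow> (\<exists>zs. length zs = k \<and> sat (ext_env zs e) A)"
proof (induction k arbitrary: e)
  case 0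
  have "ext_env [] e = e" by (auto simp: ext_env_def)
  then show ?case by (simp add: exs_def)
next
  case (Suc k)
  \<comment> \<open>The outermost quantifier of the block binds its last variable, so its value goes
    to the end of the list.\<close>
  have *: "ext_env zs (case_nat x e) = ext_env (zs @ [x]) e" for zs x
    by (rule ext) (auto simp: ext_env_def nth_append not_less Suc_diff_le
        split: nat.split intro!: arg_cong[where f = e])
  have "sat e (exs (Suc k) A) \<longleftrightarrow> (\<exists>x. sat (case_nat x e) (exs k A))"
    by (simp add: exs_def)
  also have "\<dots> \<longleftrightarrow> (\<exists>zs x. length zs = k \<and> sat (ext_env (zs @ [x]) e) A)"
    by (auto simp: Suc *)
  also have "\<dots> \<longleftrightarrow> (\<exists>zs. length zs = Suc k \<and> sat (ext_env zs e) A)"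
    by (metis length_Suc_conv_rev)
  finally show ?case .
qed

text \<open>Only primitive recursion needs an idea: the actual course of values has to be replaced
  by a beta code that agrees with it up to and including the final position.\<close>

lemma sat_graph: "sat e (graph f ts y) \<longleftrightarrow> reval f (map (tval e) ts) (tval e y)"
proof (induction f arbitrary: e ts y)
  case (Cn f gs)
  let ?k = "length gs"
  have up: "tval (ext_env zs e) (up ?k t) = tval e t" if "length zs = ?k" for zs t
    using that by (simp add: tval_up ext_env_def)
  have vars: "map (tval (ext_env zs e)) (map Var [0..<?k]) = zs" if "length zs = ?k" for zs
    using that by (auto simp: ext_env_def intro!: nth_equalityI)
  let ?C = "conjs (map2 (\<lambda>G i. G (map (up ?k) ts) (Var i)) (map graph gs) [0..<?k])"
  let ?D = "graph f (map Var [0..<?k]) (up ?k y)"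
  let ?R = "\<lambda>zs. list_all2 (\<lambda>G z. G (map (tval e) ts) z) (map reval gs) zs"
  have C: "sat (ext_env zs e) ?C \<longleftrightarrow> ?R zs" if "length zs = ?k" for zs
  proof -
    have "sat (ext_env zs e) (graph (gs ! i) (map (up ?k) ts) (Var i)) \<longleftrightarrow>
        reval (gs ! i) (map (tval e) ts) (zs ! i)" if "i < ?k" for i
      using that \<open>length zs = ?k\<close> Cn.IH(2)[of "gs ! i"]
      by (simp add: up ext_env_def comp_def cong: map_cong)
    then show ?thesis
      using that by (simp add: list_all2_conv_all_nth all_set_conv_all_nth)
  qed
  have D: "sat (ext_env zs e) ?D \<longleftrightarrow> reval f zs (tval e y)" if "length zs = ?k" for zs
    unfolding Cn.IH(1) vars[OF that] up[OF that] ..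
  have "sat e (graph (Cn f gs) ts y) \<longleftrightarrow>
      (\<exists>zs. length zs = ?k \<and> sat (ext_env zs e) ?C \<and> sat (ext_env zs e) ?D)"
    by (simp add: Let_def sat_exs)
  also have "\<dots> \<longleftrightarrow> (\<exists>zs. length zs = ?k \<and> ?R zs \<and> reval f zs (tval e y))"
    using C D by blast
  also have "\<dots> \<longleftrightarrow> reval (Cn f gs) (map (tval e) ts) (tval e y)"
    by simp (metis length_map list_all2_lengthD)
  finally show ?case .
next
  case (Pr f g)
  let ?xs = "map (tval e) ts" and ?y = "tval e y"
  have u: "tval (case_nat x (case_nat x' e)) (up 2 t) = tval e t" 
      "tval (case_nat x (case_nat x' (case_nat x'' e))) (up 3 t) = tval e t"
      "tval (case_nat x (case_nat x' (case_nat x'' (case_nat z (case_nat z' e))))) (up 5 t) = tval e t"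
    for x x' x'' z z' t
    by (simp_all add: tval_up numeral_eq_Suc)
  have "sat e (graph (Pr f g) ts y) \<longleftrightarrow> (\<exists>a b. reval f (tl ?xs) (beta a b 0) \<and>
     (\<forall>i<narg ?xs 0. reval g (i # beta a b i # tl ?xs) (beta a b (Suc i))) \<and>
      ?y = beta a b (narg ?xs 0))"
    by (simp add: Let_def Pr.IH u comp_def map_tl)
  also have "\<dots> \<longleftrightarrow> reval (Pr f g) ?xs ?y"
  proof
    assume "reval (Pr f g) ?xs ?y"
    then obtain s where s: "reval f (tl ?xs) (s 0)"
      "\<forall>i<narg ?xs 0. reval g (i # s i # tl ?xs) (s (Suc i))" "?y = s (narg ?xs 0)"
      by auto
    obtain a b where "\<And>i. i < Suc (narg ?xs 0) \<Longrightarrow> beta a b i = s i"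
      using beta_complete by metis
    then show "\<exists>a b. reval f (tl ?xs) (beta a b 0) \<and>
     (\<forall>i<narg ?xs 0. reval g (i # beta a b i # tl ?xs) (beta a b (Suc i))) \<and>
      ?y = beta a b (narg ?xs 0)"
      using s by (intro exI[of _ a] exI[of _ b]) auto
  qed auto
  finally show ?case .
next
  case (Mn f)
  have u: "tval (case_nat x (case_nat x' e)) (up 2 t) = tval e t" for x x' t
    by (simp add: tval_up numeral_eq_Suc)
  show ?case
    by (simp add: Mn.IH u comp_def)
qed auto

section \<open>Computable functions and semidecidable relations\<close>

text \<open>
  Functions and relations of several arguments are written as functions of an environment, of which
  only finitely many entries matter.  This makes the closure properties below usable as introduction
  rules: binding a variable shifts the environment, just as with de Bruijn indices.
\<close>

definition computable :: "((nat \<Rightarrow> nat) \<Rightarrow> nat) \<Rightarrow> bool" where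
  "computable F \<longleftrightarrow> (\<exists>r k. \<forall>e. reval r (map e [0..<k]) (F e))"

lemma reval_Cn_intro:
  assumes "\<And>i. i < k \<Longrightarrow> reval (g i) xs (z i)" and "reval r (map z [0..<k]) y"
  shows "reval (Cn r (map g [0..<k])) xs y"
  using assms by (auto simp: list_all2_conv_all_nth intro!: exI[of _ "map z [0..<k]"])

text \<open>Projections read missing arguments as 0 exactly as \<open>narg\<close> does, so
  precomposing with them makes a program right on argument lists of any length.\<close>

lemma computable_reval_narg:
  assumes "computable F"
  shows "\<exists>r. \<forall>xs. reval r xs (F (narg xs))"
proof -
  obtain r k where r: "\<And>e. reval r (map e [0..<k]) (F e)"
    using assms by (auto simp: computable_def)
  have "reval (Cn r (map Pj [0..<k])) xs (F (narg xs))" for xs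
    by (rule reval_Cn_intro[where z = "narg xs"]) (auto simp: r)
  then show ?thesis by blast
qed

text \<open>Surplus arguments can be projected away; this brings several programs to one common
  arity before they are composed.\<close>

lemma computable_arity:
  assumes "computable F"
  shows "\<exists>k0. \<forall>k\<ge>k0. \<exists>r. \<forall>e. reval r (map e [0..<k]) (F e)"
proof -
  obtain r k0 where r: "\<And>e. reval r (map e [0..<k0]) (F e)"
    using assms by (auto simp: computable_def)
  have "reval (Cn r (map Pj [0..<k0])) (map e [0..<k]) (F e)" if "k \<ge> k0" for k e
    by (rule reval_Cn_intro[where z = e]) (use that in \<open>auto simp: r narg_def\<close>)
  then show ?thesis by blast
qed

lemma computable_comp:
  assumes F: "computable F" and G: "\<And>i. computable (G i)"
  shows "computable (\<lambda>e. F (\<lambda>i. G i e))"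
proof -
  obtain r k where r: "\<And>e. reval r (map e [0..<k]) (F e)"
    using F by (auto simp: computable_def)
  obtain K where K: "\<And>i k. k \<ge> K i \<Longrightarrow> \<exists>r. \<forall>e. reval r (map e [0..<k]) (G i e)"
    using computable_arity[OF G] by metis
  define N where "N = (\<Sum>i<k. K i)"
  have "N \<ge> K i" if "i < k" for i
    unfolding N_def using that by (intro member_le_sum) auto
  with K have "\<forall>i<k. \<exists>r. \<forall>e. reval r (map e [0..<N]) (G i e)" by blast
  then obtain g where g: "\<And>i e. i < k \<Longrightarrow> reval (g i) (map e [0..<N]) (G i e)"
    by metis
  have "reval (Cn r (map g [0..<k])) (map e [0..<N]) (F (\<lambda>i. G i e))" for e
    by (rule reval_Cn_intro[where z = "\<lambda>i. G i e"]) (auto simp: g r)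
  then show ?thesis unfolding computable_def by blast
qed

lemma computable_var: "computable (\<lambda>e. e i)"
  unfolding computable_def
  by (intro exI[of _ "Pj i"] exI[of _ "Suc i"]) (auto simp: narg_def nth_append)

lemma computable_Suc_var: "computable (\<lambda>e. Suc (e 0))"
  unfolding computable_def by (intro exI[of _ Sc] exI[of _ 1]) (auto simp: narg_def)

lemma computable_Suc: "computable F \<Longrightarrow> computable (\<lambda>e. Suc (F e))"
  by (rule computable_comp[OF computable_Suc_var, where G = "\<lambda>_. F"])

lemma computable_const: "computable (\<lambda>e. c)"
proof (induction c)
  case 0
  show ?case unfolding computable_def by (intro exI[of _ Zr] exI[of _ 0]) auto
qed (rule computable_Suc)

text \<open>Here and below, the form \<open>F (e 0) (\<lambda>i. e (Suc i))\<close> singles out one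
  argument of \<open>F\<close> as the variable at index 0; the lemma substitutes for it.\<close>

lemma computable_app:
  assumes "computable (\<lambda>e. F (e 0) (\<lambda>i. e (Suc i)))" "computable A" "\<And>i. computable (G i)"
  shows "computable (\<lambda>e. F (A e) (\<lambda>i. G i e))"
proof -
  have "computable (case_nat A G i)" for i
    using assms(2,3) by (cases i) auto
  from computable_comp[where G = "case_nat A G", OF assms(1) this] show ?thesis by simp
qed

lemma computable_rec_var:
  assumes F: "computable F" and G: "computable (\<lambda>e. G (e 0) (e (Suc 0)) (\<lambda>i. e (Suc (Suc i))))"
  shows "computable (\<lambda>e. rec_nat (F (\<lambda>i. e (Suc i))) (\<lambda>i h. G i h (\<lambda>i. e (Suc i))) (e 0))"
proof -
  obtain k f where f: "\<And>k'. k' \<ge> k \<Longrightarrow> \<forall>e. reval (f k') (map e [0..<k']) (F e)"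
    using computable_arity[OF F] by metis
  obtain l g where g: "\<And>l'. l' \<ge> l \<Longrightarrow> \<forall>e. reval (g l') (map e [0..<l'])
      (G (e 0) (e (Suc 0)) (\<lambda>i. e (Suc (Suc i))))"
    using computable_arity[OF G] by metis
  \<comment> \<open>One number of parameters for both programs. The step program takes the counter
    and the previous value in addition, hence its arity \<open>Suc (Suc K)\<close>.\<close>
  define K where "K = max k l"
  have up: "map e [0..<Suc n] = e 0 # map (\<lambda>i. e (Suc i)) [0..<n]" for e :: "nat \<Rightarrow> nat" and n
    by (simp add: upt_conv_Cons map_Suc_upt[symmetric] del: upt_Suc)
  have f': "reval (f K) (map e [0..<K]) (F e)" for e
    using f by (simp add: K_def)
  have "reval (g (Suc (Suc K))) (map (case_nat i (case_nat h e)) [0..<Suc (Suc K)]) (G i h e)" for i h e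
  proof -
    have "l \<le> Suc (Suc K)" by (simp add: K_def)
    from g[OF this, rule_format, of "case_nat i (case_nat h e)"] show ?thesis by (simp del: upt_Suc)
  qed
  then have g': "reval (g (Suc (Suc K))) (i # h # map e [0..<K]) (G i h e)" for i h e
    unfolding up by simp
  have "reval (Pr (f K) (g (Suc (Suc K)))) (map e [0..<Suc K])
      (rec_nat (F (\<lambda>i. e (Suc i))) (\<lambda>i h. G i h (\<lambda>i. e (Suc i))) (e 0))" for e
    unfolding up
    by (auto simp: f' g' narg_def
        intro!: exI[of _ "rec_nat (F (\<lambda>i. e (Suc i))) (\<lambda>i h. G i h (\<lambda>i. e (Suc i)))"])
  then show ?thesis unfolding computable_def by blast
qed

lemma computable_rec:
  assumes "computable F" "computable (\<lambda>e. G (e 0) (e (Suc 0)) (\<lambda>i. e (Suc (Suc i))))" "computable N"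
  shows "computable (\<lambda>e. rec_nat (F e) (\<lambda>i h. G i h e) (N e))"
  by (rule computable_app[where G = "\<lambda>i e. e i", OF computable_rec_var[OF assms(1,2)] assms(3)])
     (rule computable_var)

lemma computable_add:
  assumes "computable F" "computable G" shows "computable (\<lambda>e. F e + G e)"
proof -
  have "a + b = rec_nat a (\<lambda>i h. Suc h) b" for a b :: nat
    by (induction b) auto
  then show ?thesis
    by (simp only:) (intro computable_rec[where G = "\<lambda>i h e. Suc h"] computable_Suc computable_var assms)
qed

lemma computable_mult:
  assumes "computable F" "computable G" shows "computable (\<lambda>e. F e * G e)"
proof -
  have "a * b = rec_nat 0 (\<lambda>i h. h + a) b" for a b :: nat
    by (induction b) auto
  then show ?thesis
    by (simp only:) (intro computable_rec[where G = "\<lambda>i h e. h + F e"] computable_add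
        computable_comp[OF assms(1)] computable_const computable_var assms)
qed

lemma computable_diff:
  assumes "computable F" "computable G" shows "computable (\<lambda>e. F e - G e)"
proof -
  have pred: "n - 1 = rec_nat 0 (\<lambda>i h. i) n" for n :: nat
    by (cases n) auto
  have p: "computable (\<lambda>e. e i - 1)" for i
    unfolding pred
    by (intro computable_rec[where G = "\<lambda>i h e. i"] computable_const computable_var)
  have "a - b = rec_nat a (\<lambda>i h. h - 1) b" for a b :: nat
    by (induction b) auto
  then have "(\<lambda>e. F e - G e) = (\<lambda>e. rec_nat (F e) (\<lambda>i h. h - 1) (G e))" by blast
  then show ?thesis
    by (simp only:) (intro computable_rec[where G = "\<lambda>i h e. h - 1"] p assms)
qed

lemma computable_sum:
  assumes "computable (\<lambda>e. F (e 0) (\<lambda>i. e (Suc i)))" "computable N"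
  shows "computable (\<lambda>e. \<Sum>x<N e. F x e)"
proof -
  have "(\<Sum>x<n. F x e) = rec_nat 0 (\<lambda>i h. h + F i e) n" for n e
    by (induction n) auto
  then show ?thesis
    by (simp only:) (intro computable_rec[where G = "\<lambda>i h e. h + F i e"] computable_add
        computable_app[OF assms(1)] computable_const computable_var assms)
qed

lemma computable_prod:
  assumes "computable (\<lambda>e. F (e 0) (\<lambda>i. e (Suc i)))" "computable N"
  shows "computable (\<lambda>e. \<Prod>x<N e. F x e)"
proof -
  have "(\<Prod>x<n. F x e) = rec_nat 1 (\<lambda>i h. h * F i e) n" for n e
    by (induction n) auto
  then show ?thesis
    by (simp only:) (intro computable_rec[where G = "\<lambda>i h e. h * F i e"] computable_mult
        computable_app[OF assms(1)] computable_const computable_var assms)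
qed

lemma computable_power:
  assumes "computable F" "computable G" shows "computable (\<lambda>e. F e ^ G e)"
proof -
  have "computable (\<lambda>e. \<Prod>x<G e. F e)"
    by (intro computable_prod[where F = "\<lambda>x. F"] computable_comp[OF assms(1)] computable_var assms)
  then show ?thesis by simp
qed

text \<open>The quotient counts the \<open>q < a\<close> with \<open>Suc q * b \<le> a\<close>; by
  truncated subtraction the summand is the indicator of this condition. Division by zero is set
  apart, since every summand would then be 1.\<close>

lemma div_eq_sum: "a div b = (if b = 0 then 0 else (\<Sum>q<a. 1 - (Suc q * b - a)))" for a b :: nat
proof (cases "b = 0")
  case False
  have "(1::nat) - (Suc q * b - a) = (if q < a div b then 1 else 0)" for q
    using False by (auto simp: less_eq_div_iff_mult_less_eq Suc_le_eq[symmetric] simp del: mult_Suc)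
  then have "(\<Sum>q<a. 1 - (Suc q * b - a)) = card ({..<a} \<inter> {q. q < a div b})"
    by (simp add: sum.If_cases)
  also have "{..<a} \<inter> {q. q < a div b} = {..<a div b}"
    by (auto intro: less_le_trans div_le_dividend)
  finally show ?thesis using False by simp
qed auto

lemma computable_div:
  assumes "computable F" "computable G" shows "computable (\<lambda>e. F e div G e)"
proof -
  \<comment> \<open>The factor \<open>1 - (1 - b)\<close> is 0 for \<open>b = 0\<close> and 1
    otherwise, which expresses the case distinction arithmetically.\<close>
  have "a div b = (1 - (1 - b)) * (\<Sum>q<a. 1 - (Suc q * b - a))" for a b :: nat
    by (simp add: div_eq_sum)
  then show ?thesis
    by (simp only:) (intro computable_mult computable_diff computable_const computable_Suc
        computable_sum[where F = "\<lambda>q e. 1 - (Suc q * G e - F e)"]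
        computable_comp[OF assms(1)] computable_comp[OF assms(2)] computable_var assms)
qed

lemma computable_mod:
  assumes "computable F" "computable G" shows "computable (\<lambda>e. F e mod G e)"
proof -
  have "a mod b = a - b * (a div b)" for a b :: nat
    by (simp add: minus_mult_div_eq_mod)
  then show ?thesis
    by (simp only:) (intro computable_diff computable_mult computable_div assms)
qed

lemma computable_beta:
  "computable A \<Longrightarrow> computable B \<Longrightarrow> computable I \<Longrightarrow> computable (\<lambda>e. beta (A e) (B e) (I e))"
  unfolding beta_def by (intro computable_mod computable_Suc computable_mult)

lemma computable_prod_encode:
  "computable A \<Longrightarrow> computable B \<Longrightarrow> computable (\<lambda>e. prod_encode (A e, B e))"
  unfolding prod_encode_def triangle_def prod.case
  by (intro computable_add computable_div computable_mult computable_Suc computable_const)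

lemma computable_if:
  assumes "computable F" "computable G" shows "computable (\<lambda>e. if b then F e else G e)"
  using assms by (cases b) auto

lemmas computable_intros =
  computable_const computable_var computable_Suc computable_add computable_mult computable_diff
  computable_power computable_div computable_mod computable_beta computable_prod_encode computable_if

section \<open>Semidecidable relations and their closure properties\<close>

definition semidecidable :: "((nat \<Rightarrow> nat) \<Rightarrow> bool) \<Rightarrow> bool" where
  "semidecidable P \<longleftrightarrow> (\<exists>F. computable (\<lambda>e. F (e 0) (\<lambda>i. e (Suc i))) \<and>
     (\<forall>e. P e \<longleftrightarrow> (\<exists>w. F w e = 0)))"

text \<open>Multiplying the values at all \<open>v \<le> w\<close> makes a zero persist once it is
  found. Witnesses then behave like stages of a search, and finitely many of them can be joined into
  one.\<close>

lemma semidecidable_monoE: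
  assumes "semidecidable P"
  obtains F :: "nat \<Rightarrow> (nat \<Rightarrow> nat) \<Rightarrow> nat" where "computable (\<lambda>e. F (e 0) (\<lambda>i. e (Suc i)))"
    "\<And>e. P e \<longleftrightarrow> (\<exists>w. F w e = 0)" "\<And>e w w'. w \<le> w' \<Longrightarrow> F w e = 0 \<Longrightarrow> F w' e = 0"
proof -
  obtain F where F: "computable (\<lambda>e. F (e 0) (\<lambda>i. e (Suc i)))" "\<And>e. P e \<longleftrightarrow> (\<exists>w. F w e = 0)"
    using assms by (auto simp: semidecidable_def)
  show ?thesis
  proof (rule that)
    show "computable (\<lambda>e. (\<lambda>w e. \<Prod>v<Suc w. F v e) (e 0) (\<lambda>i. e (Suc i)))"
      by (intro computable_prod[where F = "\<lambda>v e. F v (\<lambda>i. e (Suc i))"] computable_app[OF F(1)] computable_intros)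
    show "P e \<longleftrightarrow> (\<exists>w. (\<Prod>v<Suc w. F v e) = 0)" for e
      by (auto simp: F(2) simp del: prod.lessThan_Suc)
    show "(\<Prod>v<Suc w'. F v e) = 0" if "w \<le> w'" "(\<Prod>v<Suc w. F v e) = 0" for e w w'
    proof -
      obtain v where "v < Suc w" "F v e = 0"
        using \<open>(\<Prod>v<Suc w. F v e) = 0\<close> by (auto simp del: prod.lessThan_Suc)
      with \<open>w \<le> w'\<close> show ?thesis by (auto simp del: prod.lessThan_Suc)
    qed
  qed
qed

lemma semidecidable_app:
  assumes "semidecidable (\<lambda>e. P (e 0) (\<lambda>i. e (Suc i)))" "computable A" "\<And>i. computable (G i)"
  shows "semidecidable (\<lambda>e. P (A e) (\<lambda>i. G i e))"
proof -
  obtain F where F: "computable (\<lambda>e. F (e 0) (\<lambda>i. e (Suc i)))"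
    "\<And>e. P (e 0) (\<lambda>i. e (Suc i)) \<longleftrightarrow> (\<exists>w. F w e = 0)"
    using assms(1) by (auto simp: semidecidable_def)
  let ?F = "\<lambda>w e. F w (\<lambda>j. case_nat A G j e)"
  have "computable (case_nat A G j)" for j
    using assms(2,3) by (cases j) auto
  then have "computable (\<lambda>e. case_nat A G j (\<lambda>i. e (Suc i)))" for j
    by (rule computable_comp) (rule computable_var)
  then have "computable (\<lambda>e. ?F (e 0) (\<lambda>i. e (Suc i)))"
    by (intro computable_app[OF F(1) computable_var])
  moreover have "P (A e) (\<lambda>i. G i e) \<longleftrightarrow> (\<exists>w. ?F w e = 0)" for e
    using F(2)[of "\<lambda>j. case_nat A G j e"] by simp
  ultimately show ?thesis
    unfolding semidecidable_def by (intro exI[of _ ?F] conjI allI)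
qed

lemma semidecidable_app2:
  assumes P: "semidecidable (\<lambda>e. P (e 0) (e (Suc 0)) (\<lambda>i. e (Suc (Suc i))))"
    and "computable A" "computable B" "\<And>i. computable (G i)"
  shows "semidecidable (\<lambda>e. P (A e) (B e) (\<lambda>i. G i e))"
proof -
  have "computable (case_nat B G j)" for j
    using assms by (cases j) auto
  with semidecidable_app[where P = "\<lambda>x e. P x (e 0) (\<lambda>i. e (Suc i))" and G = "case_nat B G"]
  show ?thesis using assms by simp
qed

lemma semidecidable_app3:
  assumes P: "semidecidable (\<lambda>e. P (e 0) (e (Suc 0)) (e (Suc (Suc 0))) (\<lambda>i. e (Suc (Suc (Suc i)))))"
    and "computable A" "computable B" "computable C" "\<And>i. computable (G i)"
  shows "semidecidable (\<lambda>e. P (A e) (B e) (C e) (\<lambda>i. G i e))"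
proof -
  have "computable (case_nat C G j)" for j
    using assms by (cases j) auto
  with semidecidable_app2[where P = "\<lambda>x y e. P x y (e 0) (\<lambda>i. e (Suc i))" and G = "case_nat C G"]
  show ?thesis using assms by simp
qed

lemma semidecidable_eq0:
  assumes "computable F" shows "semidecidable (\<lambda>e. F e = 0)"
  unfolding semidecidable_def
  by (intro exI[of _ "\<lambda>w. F"]) (auto intro: computable_comp[OF assms] computable_var)

lemma semidecidable_eq:
  assumes "computable F" "computable G" shows "semidecidable (\<lambda>e. F e = G e)"
proof -
  have "semidecidable (\<lambda>e. (F e - G e) + (G e - F e) = 0)"
    by (intro semidecidable_eq0 computable_intros assms)
  also have "(\<lambda>e. (F e - G e) + (G e - F e) = 0) = (\<lambda>e. F e = G e)"
    by (rule ext) auto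
  finally show ?thesis .
qed

lemma semidecidable_le:
  assumes "computable F" "computable G" shows "semidecidable (\<lambda>e. F e \<le> G e)"
proof -
  have "semidecidable (\<lambda>e. F e - G e = 0)"
    by (intro semidecidable_eq0 computable_intros assms)
  then show ?thesis by simp
qed

lemma semidecidable_less:
  "computable F \<Longrightarrow> computable G \<Longrightarrow> semidecidable (\<lambda>e. F e < G e)"
  unfolding Suc_le_eq[symmetric] by (intro semidecidable_le computable_Suc)

lemma semidecidable_const: "semidecidable (\<lambda>e. b)"
  using semidecidable_eq[OF computable_const computable_const, of 0 "if b then 0 else 1"]
  by (simp split: if_splits)

lemma semidecidable_conj:
  assumes "semidecidable P" "semidecidable Q" shows "semidecidable (\<lambda>e. P e \<and> Q e)"
proof -
  obtain F where F: "computable (\<lambda>e. F (e 0) (\<lambda>i. e (Suc i)))"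
    "\<And>e. P e \<longleftrightarrow> (\<exists>w. F w e = (0::nat))" "\<And>e w w'. w \<le> w' \<Longrightarrow> F w e = 0 \<Longrightarrow> F w' e = 0"
    by (rule semidecidable_monoE[OF assms(1)]) (rule that)
  obtain G where G: "computable (\<lambda>e. G (e 0) (\<lambda>i. e (Suc i)))"
    "\<And>e. Q e \<longleftrightarrow> (\<exists>w. G w e = (0::nat))" "\<And>e w w'. w \<le> w' \<Longrightarrow> G w e = 0 \<Longrightarrow> G w' e = 0"
    by (rule semidecidable_monoE[OF assms(2)]) (rule that)
  have "P e \<and> Q e \<longleftrightarrow> (\<exists>w. F w e + G w e = 0)" for e
    unfolding F(2) G(2) using F(3) G(3) by (metis add_is_0 max.cobounded1 max.cobounded2)
  moreover have "computable (\<lambda>e. F (e 0) (\<lambda>i. e (Suc i)) + G (e 0) (\<lambda>i. e (Suc i)))"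
    by (intro computable_intros F G)
  ultimately show ?thesis unfolding semidecidable_def by (intro exI[of _ "\<lambda>w e. F w e + G w e"]) auto
qed

lemma semidecidable_disj:
  assumes "semidecidable P" "semidecidable Q" shows "semidecidable (\<lambda>e. P e \<or> Q e)"
proof -
  obtain F where F: "computable (\<lambda>e. F (e 0) (\<lambda>i. e (Suc i)))" "\<And>e. P e \<longleftrightarrow> (\<exists>w. F w e = 0)"
    using assms(1) by (auto simp: semidecidable_def)
  obtain G where G: "computable (\<lambda>e. G (e 0) (\<lambda>i. e (Suc i)))" "\<And>e. Q e \<longleftrightarrow> (\<exists>w. G w e = 0)"
    using assms(2) by (auto simp: semidecidable_def)
  have "computable (\<lambda>e. F (e 0) (\<lambda>i. e (Suc i)) * G (e 0) (\<lambda>i. e (Suc i)))"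
    by (intro computable_intros F G)
  then show ?thesis
    unfolding semidecidable_def by (intro exI[of _ "\<lambda>w e. F w e * G w e"]) (auto simp: F(2) G(2))
qed

lemma semidecidable_ex:
  assumes "semidecidable (\<lambda>e. P (e 0) (\<lambda>i. e (Suc i)))"
  shows "semidecidable (\<lambda>e. \<exists>x. P x e)"
proof -
  obtain F where F: "computable (\<lambda>e. F (e 0) (\<lambda>i. e (Suc i)))"
    "\<And>e. P (e 0) (\<lambda>i. e (Suc i)) \<longleftrightarrow> (\<exists>w. F w e = (0::nat))"
    "\<And>e w w'. w \<le> w' \<Longrightarrow> F w e = 0 \<Longrightarrow> F w' e = 0"
    by (rule semidecidable_monoE[OF assms]) (rule that)
  have P: "P x e \<longleftrightarrow> (\<exists>w. F w (case_nat x e) = 0)" for x e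
    using F(2)[of "case_nat x e"] by simp
  \<comment> \<open>A single stage \<open>w\<close> bounds both the candidates \<open>x\<close> and
    the effort spent on each of them, in place of a coded pair of candidate and witness.\<close>
  let ?H = "\<lambda>w e. \<Prod>x<w. F w (case_nat x e)"
  have "(\<exists>x. P x e) \<longleftrightarrow> (\<exists>w. ?H w e = 0)" for e
  proof
    assume "\<exists>x. P x e"
    then obtain x w where "F w (case_nat x e) = 0" using P by blast
    then have "F (max w (Suc x)) (case_nat x e) = 0" by (rule F(3)[rotated]) simp
    then show "\<exists>w. ?H w e = 0"
      by (intro exI[of _ "max w (Suc x)"]) (auto simp: less_max_iff_disj)
  qed (auto simp: P)
  moreover have "computable (\<lambda>e. ?H (e 0) (\<lambda>i. e (Suc i)))"
  proof (intro computable_prod[where F = "\<lambda>x e. F (e 0) (case_nat x (\<lambda>i. e (Suc i)))"] computable_intros)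
    have "computable (\<lambda>e. case_nat (e 0) (\<lambda>i. e (Suc (Suc i))) j)" for j
      by (cases j) (auto intro: computable_var)
    then show "computable (\<lambda>e. F (e (Suc 0)) (case_nat (e 0) (\<lambda>i. e (Suc (Suc i)))))"
      by (intro computable_app[OF F(1), where G = "\<lambda>j e. case_nat (e 0) (\<lambda>i. e (Suc (Suc i))) j"]
          computable_intros)
  qed
  ultimately show ?thesis
    unfolding semidecidable_def by (intro exI[of _ ?H] conjI allI)
qed

text \<open>At stage \<open>w\<close> one counts the elements confirmed so far, so a true lower
  bound on the count is verified eventually. This makes the frequency of inconsistency searchable;
  bounded universal quantification is the case where the count is maximal.\<close>

lemma semidecidable_card:
  assumes "semidecidable (\<lambda>e. P (e 0) (\<lambda>i. e (Suc i)))" "computable M" "computable N"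
  shows "semidecidable (\<lambda>e. M e \<le> card {x. x < N e \<and> P x e})"
proof -
  obtain F where F: "computable (\<lambda>e. F (e 0) (\<lambda>i. e (Suc i)))"
    "\<And>e. P (e 0) (\<lambda>i. e (Suc i)) \<longleftrightarrow> (\<exists>w. F w e = (0::nat))"
    "\<And>e w w'. w \<le> w' \<Longrightarrow> F w e = 0 \<Longrightarrow> F w' e = 0"
    by (rule semidecidable_monoE[OF assms(1)]) (rule that)
  have P: "P x e \<longleftrightarrow> (\<exists>w. F w (case_nat x e) = 0)" for x e
    using F(2)[of "case_nat x e"] by simp
  have card_eq: "(\<Sum>x<n. 1 - F w (case_nat x e)) = card {x. x < n \<and> F w (case_nat x e) = 0}" for n w e
  proof -
    have "(1::nat) - F w (case_nat x e) = (if F w (case_nat x e) = 0 then 1 else 0)" for x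
      by auto
    then show ?thesis by (simp add: sum.If_cases) (simp add: Collect_conj_eq lessThan_def)
  qed
  let ?H = "\<lambda>w e. M e - (\<Sum>x<N e. 1 - F w (case_nat x e))"
  have "M e \<le> card {x. x < N e \<and> P x e} \<longleftrightarrow> (\<exists>w. ?H w e = 0)" for e
  proof
    assume M: "M e \<le> card {x. x < N e \<and> P x e}"
    from P have "\<forall>x. \<exists>w. P x e \<longrightarrow> F w (case_nat x e) = 0" by blast
    from choice[OF this] obtain w where w: "\<And>x. P x e \<Longrightarrow> F (w x) (case_nat x e) = 0"
      by blast
    \<comment> \<open>The sum serves as one stage by which every true instance below
      \<open>N e\<close> is confirmed.\<close>
    define v where "v = (\<Sum>x<N e. w x)"
    have "F v (case_nat x e) = 0 \<longleftrightarrow> P x e" if "x < N e" for x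
    proof
      assume "P x e"
      have "w x \<le> v" unfolding v_def using that by (intro member_le_sum) auto
      then show "F v (case_nat x e) = 0" using w[OF \<open>P x e\<close>] by (rule F(3))
    qed (use P in blast)
    then have "{x. x < N e \<and> F v (case_nat x e) = 0} = {x. x < N e \<and> P x e}" by auto
    then show "\<exists>w. ?H w e = 0" using M unfolding card_eq by (intro exI[of _ v]) simp
  next
    assume "\<exists>w. ?H w e = 0"
    then obtain w where "M e \<le> card {x. x < N e \<and> F w (case_nat x e) = 0}"
      unfolding card_eq by auto
    also have "\<dots> \<le> card {x. x < N e \<and> P x e}"
      using P by (intro card_mono) auto
    finally show "M e \<le> card {x. x < N e \<and> P x e}" .
  qed
  moreover have "computable (\<lambda>e. ?H (e 0) (\<lambda>i. e (Suc i)))"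
  proof (intro computable_sum[where F = "\<lambda>x e. 1 - F (e 0) (case_nat x (\<lambda>i. e (Suc i)))"]
      computable_intros computable_comp[OF assms(2)] computable_comp[OF assms(3)])
    have "computable (\<lambda>e. case_nat (e 0) (\<lambda>i. e (Suc (Suc i))) j)" for j
      by (cases j) (auto intro: computable_var)
    then show "computable (\<lambda>e. F (e (Suc 0)) (case_nat (e 0) (\<lambda>i. e (Suc (Suc i)))))"
      by (intro computable_app[OF F(1), where G = "\<lambda>j e. case_nat (e 0) (\<lambda>i. e (Suc (Suc i))) j"]
          computable_intros)
  qed
  ultimately show ?thesis 
    unfolding semidecidable_def by (intro exI[of _ ?H] conjI allI)
qed

lemma semidecidable_all_less:
  assumes "semidecidable (\<lambda>e. P (e 0) (\<lambda>i. e (Suc i)))" "computable N"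
  shows "semidecidable (\<lambda>e. \<forall>x<N e. P x e)"
proof -
  have "N e \<le> card {x. x < N e \<and> P x e} \<longleftrightarrow> (\<forall>x<N e. P x e)" for e
  proof
    assume "N e \<le> card {x. x < N e \<and> P x e}"
    then have "{x. x < N e \<and> P x e} = {..<N e}" by (intro card_seteq) auto
    then show "\<forall>x<N e. P x e" by auto
  next
    assume "\<forall>x<N e. P x e"
    then have "{x. x < N e \<and> P x e} = {..<N e}" by auto
    then show "N e \<le> card {x. x < N e \<and> P x e}" by simp
  qed
  then show ?thesis using semidecidable_card[OF assms(1,2,2)] by simp
qed

lemma semidecidable_ex_less:
  assumes "semidecidable (\<lambda>e. P (e 0) (\<lambda>i. e (Suc i)))" "computable N"
  shows "semidecidable (\<lambda>e. \<exists>x<N e. P x e)"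
  by (intro semidecidable_ex[where P = "\<lambda>x e. x < N e \<and> P x e"] semidecidable_conj
      semidecidable_less assms computable_comp[OF assms(2)] computable_intros)

lemmas semidecidable_intros =
  semidecidable_const semidecidable_eq semidecidable_le semidecidable_less semidecidable_conj
  semidecidable_disj semidecidable_ex semidecidable_ex_less semidecidable_all_less

lemma reval_Mn_Least:
  assumes "\<And>t. reval r (t # xs) (G t)" and "G t0 = 0"
  shows "reval (Mn r) xs (LEAST t. G t = 0)"
proof -
  have "\<exists>v. reval r (t # xs) (Suc v)" if "t < (LEAST t. G t = 0)" for t
    using not_less_Least[OF that] assms(1)[of t] by (metis not0_implies_Suc)
  moreover have "reval r ((LEAST t. G t = 0) # xs) 0"
    using assms(1)[of "LEAST t. G t = 0"] LeastI[of "\<lambda>t. G t = 0", OF assms(2)] by simp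
  ultimately show ?thesis by simp
qed

text \<open>A partial computable choice function. One search finds a stage \<open>s\<close> by which
  some \<open>y < s\<close> is confirmed, a second one finds the least such \<open>y\<close>; the
  result is some witness, not a prescribed one.\<close>

lemma semidecidable_uniformize:
  assumes "semidecidable (\<lambda>e. R (e 0) (e (Suc 0)))"
  shows "\<exists>r. \<forall>n. (\<exists>y. R y n) \<longrightarrow> (\<exists>y. R y n \<and> reval r [n] y)"
proof -
  obtain F where F: "computable (\<lambda>e. F (e 0) (\<lambda>i. e (Suc i)))"
    "\<And>e. R (e 0) (e (Suc 0)) \<longleftrightarrow> (\<exists>w. F w e = (0::nat))"
    "\<And>e w w'. w \<le> w' \<Longrightarrow> F w e = 0 \<Longrightarrow> F w' e = 0"
    by (rule semidecidable_monoE[OF assms]) (rule that)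
  define E where "E y n = case_nat y (case_nat n (\<lambda>_. 0))" for y n :: nat
  have R: "R y n \<longleftrightarrow> (\<exists>w. F w (E y n) = 0)" for y n
    using F(2)[of "E y n"] by (simp add: E_def)
  let ?H = "\<lambda>s n. \<Prod>y<s. F s (E y n)"
  let ?G = "\<lambda>y s n. F s (E y n) * (s - y)"
  have E: "computable (\<lambda>e. E (e i) (e k) j)" for i j k
    by (cases j; cases "j - 1") (auto simp: E_def intro!: computable_intros split: nat.split)
  have "computable (\<lambda>e. ?H (e 0) (e 1))"
    by (intro computable_prod[where F = "\<lambda>y e. F (e 0) (E y (e 1))"]
        computable_app[OF F(1), where G = "\<lambda>j e. E (e _) (e _) j"] computable_intros E)
  from computable_reval_narg[OF this]
  obtain h where h: "\<And>xs. reval h xs (?H (narg xs 0) (narg xs 1))" by blast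
  have "computable (\<lambda>e. ?G (e 0) (e 1) (e 2))"
    by (intro computable_app[OF F(1), where G = "\<lambda>j e. E (e _) (e _) j"] computable_intros E)
  from computable_reval_narg[OF this]
  obtain g where g: "\<And>xs. reval g xs (?G (narg xs 0) (narg xs 1) (narg xs 2))" by blast
  have "\<exists>y. R y n \<and> reval (Cn (Mn g) [Mn h, Pj 0]) [n] y" if "R y n" for y n
  proof -
    obtain w where "F w (E y n) = 0" using \<open>R y n\<close> R by blast
    then have "F (max w (Suc y)) (E y n) = 0" by (rule F(3)[rotated]) simp
    then have "?H (max w (Suc y)) n = 0" by (intro prod_zero) auto
    define s where "s = (LEAST s. ?H s n = 0)"
    have "?H s n = 0"
      unfolding s_def by (rule LeastI[where P = "\<lambda>s. ?H s n = 0"]) fact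
    moreover have "reval (Mn h) [n] s"
      unfolding s_def
    proof (rule reval_Mn_Least)
      show "reval h [t, n] (?H t n)" for t
        using h[of "[t, n]"] by (simp add: narg_def)
    qed fact
    ultimately obtain z where z: "z < s" "F s (E z n) = 0" and s: "reval (Mn h) [n] s"
      by (auto simp: prod_zero_iff)
    then have "?G z s n = 0" by simp
    define y' where "y' = (LEAST y. ?G y s n = 0)"
    have "?G y' s n = 0"
      unfolding y'_def by (rule LeastI[where P = "\<lambda>y. ?G y s n = 0"]) fact
    moreover have "y' \<le> z" unfolding y'_def by (rule Least_le) fact
    \<comment> \<open>Because \<open>y' < s\<close>, the factor \<open>s - y'\<close> is not 0, so
      the zero comes from \<open>F\<close>.\<close>
    ultimately have "R y' n" using z(1) R by auto
    have "reval (Mn g) [s, n] y'"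
      unfolding y'_def
    proof (rule reval_Mn_Least)
      show "reval g [t, s, n] (?G t s n)" for t
        using g[of "[t, s, n]"] by (simp add: narg_def)
    qed fact
    with s have "reval (Cn (Mn g) [Mn h, Pj 0]) [n] y'"
      by (auto simp: narg_def simp del: reval.simps(6) intro!: exI[of _ "[s, n]"])
    with \<open>R y' n\<close> show ?thesis by blast
  qed
  then show ?thesis by blast
qed

section \<open>Derivations as finite sequences\<close>

inductive derivable :: "('a \<Rightarrow> bool) \<Rightarrow> ('a \<Rightarrow> 'a \<Rightarrow> 'a \<Rightarrow> bool) \<Rightarrow> 'a \<Rightarrow> bool" for Ax Step where
  axiom: "Ax x \<Longrightarrow> derivable Ax Step x"
| step: "Step x y z \<Longrightarrow> derivable Ax Step y \<Longrightarrow> derivable Ax Step z \<Longrightarrow> derivable Ax Step x"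

text \<open>A derivation tree is flattened into a list in which every entry is an axiom or follows
  from two earlier ones; a rule with a single premise cites it twice. Such a list, unlike the
  inductive definition, can be coded by numbers.\<close>

lemma derivable_iff_sequence:
  "derivable Ax Step x \<longleftrightarrow> (\<exists>s l. x = s l \<and>
     (\<forall>i<Suc l. Ax (s i) \<or> (\<exists>j<i. \<exists>k<i. Step (s i) (s j) (s k))))"
  (is "_ \<longleftrightarrow> (\<exists>s l. x = s l \<and> ?D s l)")
proof
  assume "derivable Ax Step x"
  then show "\<exists>s l. x = s l \<and> ?D s l"
  proof induction
    case (axiom x)
    then show ?case by (intro exI[of _ "\<lambda>_. x"] exI[of _ 0]) auto
  next
    case (step x y z)
    then obtain s l t r where s: "y = s l" "?D s l" and t: "z = t r" "?D t r" by auto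
    \<comment> \<open>The derivation of \<open>y\<close>, then that of \<open>z\<close> shifted by
      \<open>Suc l\<close>, then the conclusion \<open>x\<close> at position
      \<open>Suc l + Suc r\<close>.\<close>
    define u where
      "u i = (if i < Suc l then s i else if i < Suc l + Suc r then t (i - Suc l) else x)" for i
    have "Ax (u i) \<or> (\<exists>j<i. \<exists>k<i. Step (u i) (u j) (u k))" if i: "i < Suc (Suc l + Suc r)" for i
    proof -
      consider "i < Suc l" | "\<not> i < Suc l" "i < Suc l + Suc r" | "i = Suc l + Suc r" using i by linarith
      then show ?thesis
      proof cases
        case 1
        then consider "Ax (s i)" | j k where "j < i" "k < i" "Step (s i) (s j) (s k)"
          using s by blast
        then show ?thesis
        proof cases
          case 1
          then show ?thesis using \<open>i < Suc l\<close> by (simp add: u_def)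
        next
          case 2
          then have "Step (u i) (u j) (u k)" using \<open>i < Suc l\<close> by (simp add: u_def)
          then show ?thesis using 2 by blast
        qed
      next
        case 2
        define i' where "i' = i - Suc l"
        have "i' < Suc r" using 2 by (auto simp: i'_def)
        have ui: "u i = t i'" using 2 by (simp add: u_def i'_def)
        consider "Ax (t i')" | j k where "j < i'" "k < i'" "Step (t i') (t j) (t k)"
          using t \<open>i' < Suc r\<close> by blast
        then show ?thesis
        proof cases
          case 1
          then show ?thesis using ui by simp
        next
          case (2 j k)
          have "u (Suc l + j) = t j" "u (Suc l + k) = t k"
            using 2 \<open>i' < Suc r\<close> by (auto simp: u_def)
          then have "Step (u i) (u (Suc l + j)) (u (Suc l + k))" using ui 2 by simp
          moreover have "Suc l + j < i" "Suc l + k < i" using 2 by (auto simp: i'_def)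
          ultimately show ?thesis by blast
        qed
      next
        case 3
        have "u i = x" "u l = y" "u (Suc l + r) = z" using s t 3 by (auto simp: u_def)
        then have "Step (u i) (u l) (u (Suc l + r))" using step.hyps by simp
        moreover have "l < i" "Suc l + r < i" using 3 by auto
        ultimately show ?thesis by blast
      qed
    qed
    moreover have "x = u (Suc l + Suc r)" by (simp add: u_def)
    ultimately show ?case by blast
  qed
next
  assume "\<exists>s l. x = s l \<and> ?D s l"
  then obtain s l where x: "x = s l" and D: "?D s l" by blast
  have "derivable Ax Step (s i)" if "i < Suc l" for i
    using that
  proof (induction i rule: less_induct)
    case (less i)
    then consider "Ax (s i)" | j k where "j < i" "k < i" "Step (s i) (s j) (s k)"
      using D by blast
    then show ?case
    proof cases
      case 1
      then show ?thesis by (rule derivable.axiom)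
    next
      case (2 j k)
      then have "derivable Ax Step (s j)" "derivable Ax Step (s k)"
        using less.IH[of j] less.IH[of k] less.prems by simp_all
      with 2(3) show ?thesis by (rule derivable.step)
    qed
  qed
  then show "derivable Ax Step x" using x by blast
qed

text \<open>A derivation is guessed as a beta code with a length, and checking a step only refers to
  earlier positions. Substitution in terms, substitution in formulas and provability are all
  enumerated in this way.\<close>

lemma semidecidable_derivable:
  assumes Ax: "semidecidable (\<lambda>e. Ax (e 0) (\<lambda>i. e (Suc i)))"
    and Step: "semidecidable (\<lambda>e. Step (e 0) (e (Suc 0)) (e (Suc (Suc 0))) (\<lambda>i. e (Suc (Suc (Suc i)))))"
    and X: "computable X"
  shows "semidecidable (\<lambda>e. derivable (\<lambda>x. Ax x e) (\<lambda>x y z. Step x y z e) (X e))"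
proof -
  have "derivable (\<lambda>x. Ax x e) (\<lambda>x y z. Step x y z e) (X e) \<longleftrightarrow>
     (\<exists>a b l. X e = beta a b l \<and> (\<forall>i<Suc l. Ax (beta a b i) e \<or>
        (\<exists>j<i. \<exists>k<i. Step (beta a b i) (beta a b j) (beta a b k) e)))" (is "?L \<longleftrightarrow> ?R") for e
  proof
    assume ?L
    then obtain s l where s: "X e = s l"
      "\<And>i. i < Suc l \<Longrightarrow> Ax (s i) e \<or> (\<exists>j<i. \<exists>k<i. Step (s i) (s j) (s k) e)"
      unfolding derivable_iff_sequence by blast
    obtain a b where ab: "\<And>i. i < Suc l \<Longrightarrow> beta a b i = s i"
      using beta_complete by metis
    have "Ax (beta a b i) e \<or> (\<exists>j<i. \<exists>k<i. Step (beta a b i) (beta a b j) (beta a b k) e)"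
      if "i < Suc l" for i
      using s(2)[OF that] ab that by (metis less_trans)
    moreover have "X e = beta a b l" using s ab by simp
    ultimately show ?R by blast
  qed (auto simp: derivable_iff_sequence)
  then show ?thesis
    by (simp only:) (intro semidecidable_intros semidecidable_app[where P = Ax, OF Ax]
        semidecidable_app3[where P = Step, OF Step] computable_intros computable_comp[OF X])
qed

section \<open>Goedel numbering\<close>

abbreviation pr :: "nat \<Rightarrow> nat \<Rightarrow> nat" where "pr x y \<equiv> prod_encode (x, y)"

primrec tcode :: "trm \<Rightarrow> nat" where
  "tcode (Var i) = pr 0 i"
| "tcode Zero = pr 1 0"
| "tcode (Succ t) = pr 2 (tcode t)"
| "tcode (Plus t u) = pr 3 (pr (tcode t) (tcode u))"
| "tcode (Times t u) = pr 4 (pr (tcode t) (tcode u))"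

primrec fcode :: "fm \<Rightarrow> nat" where
  "fcode (t \<^bold>= u) = pr 0 (pr (tcode t) (tcode u))"
| "fcode \<^bold>\<bottom> = pr 1 0"
| "fcode (A \<^bold>\<longrightarrow> B) = pr 2 (pr (fcode A) (fcode B))"
| "fcode (\<^bold>\<forall> A) = pr 3 (fcode A)"

lemma tcode_inject [simp]: "tcode t = tcode u \<longleftrightarrow> t = u"
proof (induction t arbitrary: u)
  case (Var i) show ?case by (cases u) auto
next
  case Zero show ?case by (cases u) auto
next
  case (Succ t) then show ?case by (cases u) auto
next
  case (Plus t1 t2) then show ?case by (cases u) auto
next
  case (Times t1 t2) then show ?case by (cases u) auto
qed

lemma fcode_inject [simp]: "fcode A = fcode B \<longleftrightarrow> A = B"
proof (induction A arbitrary: B)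
  case (Eq t u) show ?case by (cases B) auto
next
  case Falsum show ?case by (cases B) auto
next
  case (Imp A1 A2) then show ?case by (cases B) auto
next
  case (Forall A) then show ?case by (cases B) auto
qed

text \<open>
  The three kinds of substitution that occur in the axioms, pushed below \<open>k\<close> quantifiers, are of
  this form: variable \<open>k\<close> is replaced by \<open>s\<close>, and the variables above it are shifted by \<open>d - 1\<close>.
\<close>

definition sub :: "trm \<Rightarrow> nat \<Rightarrow> nat \<Rightarrow> nat \<Rightarrow> trm" where
  "sub s d k i = (if i < k then Var i else if i = k then s else Var (i + d - 1))"

text \<open>The shape of these substitutions is stable: passing a quantifier changes only
  \<open>s\<close> and \<open>k\<close>. A substitution, an infinite object, is thus given by a term
  and two numbers throughout.\<close>

lemma sub_lift: "case_nat (Var 0) (\<lambda>i. up 1 (sub s d k i)) = sub (up 1 s) d (Suc k)"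
  by (rule ext) (auto simp: sub_def up_def split: nat.split)

lemma inst_eq_sub: "inst t = fsubst (sub t 0 0)"
proof -
  have "case_nat t Var = sub t 0 0" by (rule ext) (auto simp: sub_def split: nat.split)
  then show ?thesis by (simp add: inst_def)
qed

lemma flift_eq_sub: "flift = fsubst (sub (Var 1) 2 0)"
proof -
  have "(\<lambda>i. Var (Suc i)) = sub (Var 1) 2 0" by (rule ext) (auto simp: sub_def)
  then show ?thesis by (simp add: flift_def)
qed

lemma up_1_eq_sub: "up 1 = tsubst (sub (Var 1) 2 0)"
proof -
  have "(\<lambda>i. Var (i + 1)) = sub (Var 1) 2 0" by (rule ext) (auto simp: sub_def)
  then show ?thesis by (simp add: up_def)
qed

lemma succ_eq_sub: "case_nat (Succ (Var 0)) (\<lambda>i. Var (Suc i)) = sub (Succ (Var 0)) 1 0"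
  by (rule ext) (auto simp: sub_def split: nat.split)

section \<open>Substitution as an enumerable relation on codes\<close>

definition tsub_axiom :: "nat \<Rightarrow> nat \<Rightarrow> nat \<Rightarrow> nat \<Rightarrow> bool" where
  "tsub_axiom s d k x \<longleftrightarrow> (\<exists>i<k. x = pr (pr 0 i) (pr 0 i)) \<or> x = pr (pr 0 k) s \<or>
     (\<exists>i. k < i \<and> x = pr (pr 0 i) (pr 0 (i + d - 1))) \<or> x = pr (pr 1 0) (pr 1 0)"

definition tsub_step :: "nat \<Rightarrow> nat \<Rightarrow> nat \<Rightarrow> bool" where
  "tsub_step x y z \<longleftrightarrow> (\<exists>t t' u u'. y = pr t t' \<and> z = pr u u' \<and>
     (x = pr (pr 2 t) (pr 2 t') \<or> x = pr (pr 3 (pr t u)) (pr 3 (pr t' u')) \<or>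
      x = pr (pr 4 (pr t u)) (pr 4 (pr t' u'))))"

text \<open>The rules generate the pairs of the code of a term and the code of its image. The graph
  is enough, as only semidecidability is asked for.\<close>

definition tsub_code :: "nat \<Rightarrow> nat \<Rightarrow> nat \<Rightarrow> nat \<Rightarrow> nat \<Rightarrow> bool" where
  "tsub_code s d k x y \<longleftrightarrow> derivable (tsub_axiom s d k) tsub_step (pr x y)"

lemma tsub_code_iff:
  "tsub_code (tcode s) d k x y \<longleftrightarrow> (\<exists>t. x = tcode t \<and> y = tcode (tsubst (sub s d k) t))"
proof
  have "\<exists>t. z = pr (tcode t) (tcode (tsubst (sub s d k) t))"
    if "derivable (tsub_axiom (tcode s) d k) tsub_step z" for z
    using that
  proof induction
    case (axiom x)
    then consider i where "i < k" "x = pr (pr 0 i) (pr 0 i)" | "x = pr (pr 0 k) (tcode s)"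
      | i where "k < i" "x = pr (pr 0 i) (pr 0 (i + d - 1))" | "x = pr (pr 1 0) (pr 1 0)"
      by (auto simp: tsub_axiom_def)
    then show ?case
    proof cases
      case (1 i)
      then show ?thesis by (intro exI[of _ "Var i"]) (simp add: sub_def)
    next
      case 2
      then show ?thesis by (intro exI[of _ "Var k"]) (simp add: sub_def)
    next
      case (3 i)
      then show ?thesis by (intro exI[of _ "Var i"]) (simp add: sub_def)
    next
      case 4
      then show ?thesis by (intro exI[of _ Zero]) simp
    qed
  next
    case (step x y z)
    then obtain t u where
      y: "y = pr (tcode t) (tcode (tsubst (sub s d k) t))" and
      z: "z = pr (tcode u) (tcode (tsubst (sub s d k) u))" by auto
    from step.hyps(1) show ?case
      unfolding tsub_step_def y z by clarsimp (metis tcode.simps tsubst.simps)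
  qed
  then show "tsub_code (tcode s) d k x y \<Longrightarrow> \<exists>t. x = tcode t \<and> y = tcode (tsubst (sub s d k) t)"
    by (fastforce simp: tsub_code_def)
  have "tsub_code (tcode s) d k (tcode t) (tcode (tsubst (sub s d k) t))" for t
    unfolding tsub_code_def
  proof (induction t)
    case (Var i)
    show ?case
      by (rule derivable.axiom) (auto simp: tsub_axiom_def sub_def)
  next
    case Zero
    show ?case by (rule derivable.axiom) (auto simp: tsub_axiom_def)
  next
    case (Succ t)
    show ?case by (rule derivable.step[OF _ Succ Succ]) (auto simp: tsub_step_def)
  next
    case (Plus t u)
    show ?case by (rule derivable.step[OF _ Plus]) (auto simp: tsub_step_def)
  next
    case (Times t u)
    show ?case by (rule derivable.step[OF _ Times]) (auto simp: tsub_step_def)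
  qed
  then show "\<exists>t. x = tcode t \<and> y = tcode (tsubst (sub s d k) t) \<Longrightarrow> tsub_code (tcode s) d k x y"
    by blast
qed

lemma semidecidable_tsub_code:
  assumes "computable S" "computable D" "computable K" "computable X" "computable Y"
  shows "semidecidable (\<lambda>e. tsub_code (S e) (D e) (K e) (X e) (Y e))"
  unfolding tsub_code_def tsub_axiom_def tsub_step_def
  by (intro semidecidable_derivable[where Ax = "\<lambda>x e. (\<exists>i<K e. x = pr (pr 0 i) (pr 0 i)) \<or>
        x = pr (pr 0 (K e)) (S e) \<or> (\<exists>i. K e < i \<and> x = pr (pr 0 i) (pr 0 (i + D e - 1))) \<or>
        x = pr (pr 1 0) (pr 1 0)"]
      semidecidable_intros computable_intros assms computable_comp[OF assms(1)]
      computable_comp[OF assms(2)] computable_comp[OF assms(3)])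

text \<open>Term codes are recognized as the domain of a substitution, which saves a separate
  recursion; \<open>pr 1 0\<close> is the code of \<open>Zero\<close>.\<close>

definition is_tcode :: "nat \<Rightarrow> bool" where
  "is_tcode x \<longleftrightarrow> (\<exists>y. tsub_code (pr 1 0) 0 0 x y)"

lemma is_tcode_iff: "is_tcode x \<longleftrightarrow> (\<exists>t. x = tcode t)"
  unfolding is_tcode_def tsub_code_iff[of Zero, unfolded tcode.simps] by blast

lemma semidecidable_is_tcode:
  assumes "computable X" shows "semidecidable (\<lambda>e. is_tcode (X e))"
  unfolding is_tcode_def
  by (intro semidecidable_intros semidecidable_tsub_code computable_intros computable_comp[OF assms])

definition up_code :: "nat \<Rightarrow> nat \<Rightarrow> bool" where
  "up_code x y \<longleftrightarrow> tsub_code (pr 0 1) 2 0 x y"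

lemma up_code_iff: "up_code x y \<longleftrightarrow> (\<exists>t. x = tcode t \<and> y = tcode (up 1 t))"
  unfolding up_code_def up_1_eq_sub using tsub_code_iff[of "Var 1"] by simp

text \<open>The derived objects also carry \<open>s\<close> and \<open>k\<close>, which change when
  the substitution passes a quantifier; the shift \<open>d\<close> does not change and stays a
  parameter.\<close>

definition fsub_axiom :: "nat \<Rightarrow> nat \<Rightarrow> bool" where
  "fsub_axiom d x \<longleftrightarrow>
     (\<exists>s k. is_tcode s \<and> (x = pr s (pr k (pr (pr 1 0) (pr 1 0))) \<or>
       (\<exists>t t' u u'. tsub_code s d k t t' \<and> tsub_code s d k u u' \<and>
          x = pr s (pr k (pr (pr 0 (pr t u)) (pr 0 (pr t' u')))))))"

definition fsub_step :: "nat \<Rightarrow> nat \<Rightarrow> nat \<Rightarrow> bool" where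
  "fsub_step x y z \<longleftrightarrow>
     (\<exists>s k a a'. (\<exists>s'. up_code s s' \<and>
         y = pr s' (pr (Suc k) (pr a a')) \<and> x = pr s (pr k (pr (pr 3 a) (pr 3 a')))) \<or>
       (\<exists>b b'. y = pr s (pr k (pr a a')) \<and> z = pr s (pr k (pr b b')) \<and>
         x = pr s (pr k (pr (pr 2 (pr a b)) (pr 2 (pr a' b'))))))"

definition fsub_code :: "nat \<Rightarrow> nat \<Rightarrow> nat \<Rightarrow> nat \<Rightarrow> nat \<Rightarrow> bool" where
  "fsub_code s d k x y \<longleftrightarrow> derivable (fsub_axiom d) fsub_step (pr s (pr k (pr x y)))"

text \<open>That \<open>c\<close> codes a term is part of the conclusion, because the axioms for
  instantiation and equality quantify over arbitrary numbers \<open>c\<close>. The test in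
  \<open>fsub_axiom\<close> ensures it even for formulas without terms.\<close>

lemma fsub_code_iff:
  "fsub_code c d k x y \<longleftrightarrow>
     (\<exists>s A. c = tcode s \<and> x = fcode A \<and> y = fcode (fsubst (sub s d k) A))"
proof
  have "\<exists>s k A. z = pr (tcode s) (pr k (pr (fcode A) (fcode (fsubst (sub s d k) A))))"
    if "derivable (fsub_axiom d) fsub_step z" for z
    using that
  proof induction
    case (axiom x)
    then obtain c k where "is_tcode c" and
      *: "x = pr c (pr k (pr (pr 1 0) (pr 1 0))) \<or>
       (\<exists>t t' u u'. tsub_code c d k t t' \<and> tsub_code c d k u u' \<and>
          x = pr c (pr k (pr (pr 0 (pr t u)) (pr 0 (pr t' u')))))"
      unfolding fsub_axiom_def by blast
    then obtain s where s: "c = tcode s" by (auto simp: is_tcode_iff)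
    from * show ?case unfolding s tsub_code_iff
    proof (elim disjE exE conjE)
      assume "x = pr (tcode s) (pr k (pr (pr 1 0) (pr 1 0)))"
      then show ?thesis by (intro exI[of _ s] exI[of _ k] exI[of _ "\<^bold>\<bottom>"]) simp
    next
      fix t t' u u' v w
      assume "x = pr (tcode s) (pr k (pr (pr 0 (pr t u)) (pr 0 (pr t' u'))))"
        "t = tcode v" "t' = tcode (tsubst (sub s d k) v)"
        "u = tcode w" "u' = tcode (tsubst (sub s d k) w)"
      then show ?thesis by (intro exI[of _ s] exI[of _ k] exI[of _ "v \<^bold>= w"]) simp
    qed
  next
    case (step x y z)
    from step.IH obtain s k A s' k' B where
      y: "y = pr (tcode s) (pr k (pr (fcode A) (fcode (fsubst (sub s d k) A))))" and
      z: "z = pr (tcode s') (pr k' (pr (fcode B) (fcode (fsubst (sub s' d k') B))))" by blast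
    from step.hyps(1) show ?case
      unfolding fsub_step_def
    proof (elim disjE exE conjE)
      fix c j a a' c'
      assume "up_code c c'" and *: "y = pr c' (pr (Suc j) (pr a a'))"
        and x: "x = pr c (pr j (pr (pr 3 a) (pr 3 a')))"
      then obtain t where "c = tcode t" "c' = tcode (up 1 t)" by (auto simp: up_code_iff)
      then show ?thesis using * unfolding x y
        by (intro exI[of _ t] exI[of _ j] exI[of _ "\<^bold>\<forall> A"]) (auto simp: sub_lift[unfolded One_nat_def])
    next
      fix c j a a' b b'
      assume "y = pr c (pr j (pr a a'))" "z = pr c (pr j (pr b b'))"
        and x: "x = pr c (pr j (pr (pr 2 (pr a b)) (pr 2 (pr a' b'))))"
      then show ?thesis unfolding x y z
        by (intro exI[of _ s] exI[of _ k] exI[of _ "A \<^bold>\<longrightarrow> B"]) auto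
    qed
  qed
  then show "fsub_code c d k x y \<Longrightarrow>
     \<exists>s A. c = tcode s \<and> x = fcode A \<and> y = fcode (fsubst (sub s d k) A)"
    by (fastforce simp: fsub_code_def)
  have "fsub_code (tcode s) d k (fcode A) (fcode (fsubst (sub s d k) A))" for s A
    unfolding fsub_code_def
  proof (induction A arbitrary: s k)
    case (Eq t u)
    show ?case
      by (rule derivable.axiom) (auto simp: fsub_axiom_def is_tcode_iff tsub_code_iff)
  next
    case Falsum
    show ?case by (rule derivable.axiom) (auto simp: fsub_axiom_def is_tcode_iff)
  next
    case (Imp A B)
    show ?case by (rule derivable.step[OF _ Imp]) (auto simp: fsub_step_def)
  next
    case (Forall A)
    have "fsubst (sub s d k) (\<^bold>\<forall> A) = \<^bold>\<forall> (fsubst (sub (up 1 s) d (Suc k)) A)"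
      by (simp only: fsubst.simps sub_lift)
    moreover have "up_code (tcode s) (tcode (up 1 s))" by (auto simp: up_code_iff)
    ultimately show ?case
      by (intro derivable.step[OF _ Forall Forall, of _ "up 1 s" "Suc k" "up 1 s" "Suc k"])
         (auto simp: fsub_step_def)
  qed
  then show "\<exists>s A. c = tcode s \<and> x = fcode A \<and> y = fcode (fsubst (sub s d k) A) \<Longrightarrow>
      fsub_code c d k x y"
    by blast
qed

lemma semidecidable_fsub_code:
  assumes "computable S" "computable D" "computable K" "computable X" "computable Y"
  shows "semidecidable (\<lambda>e. fsub_code (S e) (D e) (K e) (X e) (Y e))"
  unfolding fsub_code_def
proof (intro semidecidable_derivable[where Ax = "\<lambda>x e. fsub_axiom (D e) x" and Step = "\<lambda>x y z e. fsub_step x y z"])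
  show "semidecidable (\<lambda>e. fsub_axiom (D (\<lambda>i. e (Suc i))) (e 0))"
    unfolding fsub_axiom_def
    by (intro semidecidable_intros semidecidable_is_tcode semidecidable_tsub_code
        computable_intros computable_comp[OF assms(2)])
  show "semidecidable (\<lambda>e. fsub_step (e 0) (e (Suc 0)) (e (Suc (Suc 0))))"
    unfolding fsub_step_def up_code_def
    by (intro semidecidable_intros semidecidable_tsub_code computable_intros)
qed (intro computable_intros assms)

definition is_fcode :: "nat \<Rightarrow> bool" where
  "is_fcode x \<longleftrightarrow> (\<exists>y. fsub_code (pr 1 0) 0 0 x y)"

lemma is_fcode_iff: "is_fcode x \<longleftrightarrow> (\<exists>A. x = fcode A)"
proof -
  have "pr 1 0 = tcode s \<longleftrightarrow> s = Zero" for s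
    using tcode_inject[of Zero s] by auto
  then show ?thesis unfolding is_fcode_def fsub_code_iff by auto
qed

lemma semidecidable_is_fcode:
  assumes "computable X" shows "semidecidable (\<lambda>e. is_fcode (X e))"
  unfolding is_fcode_def
  by (intro semidecidable_intros semidecidable_fsub_code computable_intros computable_comp[OF assms])

section \<open>Coded axioms and proofs of Peano arithmetic\<close>

abbreviation imp_code :: "nat \<Rightarrow> nat \<Rightarrow> nat" where "imp_code a b \<equiv> pr 2 (pr a b)"
abbreviation all_code :: "nat \<Rightarrow> nat" where "all_code a \<equiv> pr 3 a"

text \<open>The disjuncts follow the rules from \<open>AxK\<close> to \<open>AxLeibniz\<close>.
  Instantiation by a term is \<open>fsub_code t 0 0\<close>, \<open>flift\<close> is
  \<open>fsub_code (pr 0 1) 2 0\<close>, and \<open>pr 1 0\<close> as the code of a formula is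
  falsum.\<close>

definition logical_axiom :: "nat \<Rightarrow> bool" where
  "logical_axiom x \<longleftrightarrow>
     (\<exists>a b. is_fcode a \<and> is_fcode b \<and> x = imp_code a (imp_code b a)) \<or>
     (\<exists>a b c. is_fcode a \<and> is_fcode b \<and> is_fcode c \<and>
        x = imp_code (imp_code a (imp_code b c)) (imp_code (imp_code a b) (imp_code a c))) \<or>
     (\<exists>a. is_fcode a \<and> x = imp_code (imp_code (imp_code a (pr 1 0)) (pr 1 0)) a) \<or>
     (\<exists>t a a'. fsub_code t 0 0 a a' \<and> x = imp_code (all_code a) a') \<or>
     (\<exists>a b. is_fcode a \<and> is_fcode b \<and>
        x = imp_code (all_code (imp_code a b)) (imp_code (all_code a) (all_code b))) \<or>
     (\<exists>a a'. fsub_code (pr 0 1) 2 0 a a' \<and> x = imp_code a (all_code a')) \<or>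
     (\<exists>t. is_tcode t \<and> x = pr 0 (pr t t)) \<or>
     (\<exists>t u a a1 a2. fsub_code t 0 0 a a1 \<and> fsub_code u 0 0 a a2 \<and>
        x = imp_code (pr 0 (pr t u)) (imp_code a1 a2))"

text \<open>In the induction scheme \<open>pr 1 0\<close> codes \<open>Zero\<close> and
  \<open>pr 2 (pr 0 0)\<close> codes \<open>Succ (Var 0)\<close>; the shift \<open>d = 1\<close>
  leaves the other variables in place.\<close>

definition PA_axiom :: "nat \<Rightarrow> bool" where
  "PA_axiom x \<longleftrightarrow>
     x = fcode (\<^bold>\<not> Succ (Var 0) \<^bold>= Zero) \<or>
     x = fcode (Succ (Var 0) \<^bold>= Succ (Var 1) \<^bold>\<longrightarrow> Var 0 \<^bold>= Var 1) \<or>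
     x = fcode (Plus (Var 0) Zero \<^bold>= Var 0) \<or>
     x = fcode (Plus (Var 0) (Succ (Var 1)) \<^bold>= Succ (Plus (Var 0) (Var 1))) \<or>
     x = fcode (Times (Var 0) Zero \<^bold>= Zero) \<or>
     x = fcode (Times (Var 0) (Succ (Var 1)) \<^bold>= Plus (Times (Var 0) (Var 1)) (Var 0)) \<or>
     (\<exists>a a0 a1. fsub_code (pr 1 0) 0 0 a a0 \<and> fsub_code (pr 2 (pr 0 0)) 1 0 a a1 \<and>
        x = imp_code a0 (imp_code (all_code (imp_code a a1)) (all_code a)))"

definition inference :: "nat \<Rightarrow> nat \<Rightarrow> nat \<Rightarrow> bool" where
  "inference x y z \<longleftrightarrow> y = imp_code z x \<or> x = all_code y"

lemma fsub_code_tcode_iff: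
  "fsub_code (tcode s) d k x y \<longleftrightarrow> (\<exists>A. x = fcode A \<and> y = fcode (fsubst (sub s d k) A))"
  by (auto simp: fsub_code_iff)

lemma PA_axiom_iff: "PA_axiom x \<longleftrightarrow> (\<exists>A\<in>PA. x = fcode A)"
proof
  note sub = fsub_code_tcode_iff[of Zero, simplified] fsub_code_tcode_iff[of "Succ (Var 0)", simplified]
  show "PA_axiom x \<Longrightarrow> \<exists>A\<in>PA. x = fcode A"
    unfolding PA_axiom_def
  proof (elim disjE exE conjE)
    fix a a0 a1
    assume *: "fsub_code (pr 1 0) 0 0 a a0" "fsub_code (pr 2 (pr 0 0)) 1 0 a a1"
      and x: "x = imp_code a0 (imp_code (all_code (imp_code a a1)) (all_code a))"
    from * obtain A where "a = fcode A" "a0 = fcode (inst Zero A)"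
        "a1 = fcode (fsubst (case_nat (Succ (Var 0)) (\<lambda>i. Var (Suc i))) A)"
      unfolding succ_eq_sub inst_eq_sub by (auto simp: sub)
    then have "x = fcode (inst Zero A \<^bold>\<longrightarrow>
     \<^bold>\<forall> (A \<^bold>\<longrightarrow> fsubst (case_nat (Succ (Var 0)) (\<lambda>i. Var (Suc i))) A) \<^bold>\<longrightarrow> \<^bold>\<forall> A)"
      using x by simp
    then show ?thesis using PA.intros(7) by blast
  qed (blast intro: PA.intros)+
  have "PA_axiom (fcode A)" if "A \<in> PA" for A
    using that
  proof cases
    case (7 A)
    have "fsub_code (pr 1 0) 0 0 (fcode A) (fcode (inst Zero A))"
      unfolding inst_eq_sub by (auto simp: sub)
    moreover have "fsub_code (pr 2 (pr 0 0)) 1 0 (fcode A)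
        (fcode (fsubst (case_nat (Succ (Var 0)) (\<lambda>i. Var (Suc i))) A))"
      unfolding succ_eq_sub by (auto simp: sub)
    ultimately show ?thesis unfolding PA_axiom_def 7 by (auto intro!: exI)
  qed (auto simp: PA_axiom_def)
  then show "\<exists>A\<in>PA. x = fcode A \<Longrightarrow> PA_axiom x" by blast
qed

lemma logical_axiom_sound: 
  assumes "logical_axiom x" shows "\<exists>A. x = fcode A \<and> T \<turnstile> A"
proof -
  have lift: "\<exists>A. a = fcode A \<and> a' = fcode (flift A)" if "fsub_code (pr 0 1) 2 0 a a'" for a a'
    using that fsub_code_tcode_iff[of "Var 1" 2 0] by (auto simp: flift_eq_sub)
  have inst: "\<exists>s A. c = tcode s \<and> a = fcode A \<and> a' = fcode (inst s A)" if "fsub_code c 0 0 a a'" for c a a'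
    using that by (auto simp: fsub_code_iff inst_eq_sub)
  show ?thesis
    using assms unfolding logical_axiom_def
  proof (elim disjE exE conjE)
    fix a b assume "is_fcode a" "is_fcode b" and x: "x = imp_code a (imp_code b a)"
    then obtain A B where "a = fcode A" "b = fcode B" by (auto simp: is_fcode_iff)
    then show ?thesis using x by (intro exI[of _ "A \<^bold>\<longrightarrow> B \<^bold>\<longrightarrow> A"]) (auto intro: provable.intros)
  next
    fix a b c assume "is_fcode a" "is_fcode b" "is_fcode c" and
      x: "x = imp_code (imp_code a (imp_code b c)) (imp_code (imp_code a b) (imp_code a c))"
    then obtain A B C where "a = fcode A" "b = fcode B" "c = fcode C" by (auto simp: is_fcode_iff)
    then show ?thesis using x
      by (intro exI[of _ "(A \<^bold>\<longrightarrow> B \<^bold>\<longrightarrow> C) \<^bold>\<longrightarrow> (A \<^bold>\<longrightarrow> B) \<^bold>\<longrightarrow> A \<^bold>\<longrightarrow> C"]) (auto intro: provable.AxS)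
  next
    fix a assume "is_fcode a" and x: "x = imp_code (imp_code (imp_code a (pr 1 0)) (pr 1 0)) a"
    then obtain A where "a = fcode A" by (auto simp: is_fcode_iff)
    then show ?thesis using x by (intro exI[of _ "\<^bold>\<not> \<^bold>\<not> A \<^bold>\<longrightarrow> A"]) (auto intro: provable.AxDN)
  next
    fix t a a' assume "fsub_code t 0 0 a a'" and x: "x = imp_code (all_code a) a'"
    then obtain s A where "t = tcode s" "a = fcode A" "a' = fcode (inst s A)" using inst by blast
    then show ?thesis using x by (intro exI[of _ "\<^bold>\<forall> A \<^bold>\<longrightarrow> inst s A"]) (auto intro: provable.AxInst)
  next
    fix a b assume "is_fcode a" "is_fcode b" and
      x: "x = imp_code (all_code (imp_code a b)) (imp_code (all_code a) (all_code b))"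
    then obtain A B where "a = fcode A" "b = fcode B" by (auto simp: is_fcode_iff)
    then show ?thesis using x
      by (intro exI[of _ "\<^bold>\<forall> (A \<^bold>\<longrightarrow> B) \<^bold>\<longrightarrow> \<^bold>\<forall> A \<^bold>\<longrightarrow> \<^bold>\<forall> B"]) (auto intro: provable.AxDist)
  next
    fix a a' assume "fsub_code (pr 0 1) 2 0 a a'" and x: "x = imp_code a (all_code a')"
    then obtain A where "a = fcode A" "a' = fcode (flift A)" using lift by blast
    then show ?thesis using x by (intro exI[of _ "A \<^bold>\<longrightarrow> \<^bold>\<forall> (flift A)"]) (auto intro: provable.AxVac)
  next
    fix t assume "is_tcode t" and x: "x = pr 0 (pr t t)"
    then obtain s where "t = tcode s" by (auto simp: is_tcode_iff)
    then show ?thesis using x by (intro exI[of _ "s \<^bold>= s"]) (auto intro: provable.AxRefl)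
  next
    fix t u a a1 a2 assume "fsub_code t 0 0 a a1" "fsub_code u 0 0 a a2"
      and x: "x = imp_code (pr 0 (pr t u)) (imp_code a1 a2)"
    then obtain r s A where "t = tcode r" "u = tcode s" "a = fcode A" "a1 = fcode (inst r A)"
      "a2 = fcode (inst s A)" using inst by (metis fcode_inject)
    then show ?thesis using x
      by (intro exI[of _ "r \<^bold>= s \<^bold>\<longrightarrow> inst r A \<^bold>\<longrightarrow> inst s A"]) (auto intro: provable.AxLeibniz)
  qed
qed

lemma provable_iff_derivable:
  "PA \<union> E \<turnstile> A \<longleftrightarrow>
     derivable (\<lambda>x. logical_axiom x \<or> PA_axiom x \<or> (\<exists>B\<in>E. x = fcode B)) inference (fcode A)"
  (is "_ \<longleftrightarrow> derivable ?Ax _ _")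
proof
  have f: "is_fcode (fcode A)" for A by (auto simp: is_fcode_iff)
  have t: "is_tcode (tcode s)" for s by (auto simp: is_tcode_iff)
  have i: "fsub_code (tcode s) 0 0 (fcode A) (fcode (inst s A))" for s A
    by (auto simp: fsub_code_tcode_iff inst_eq_sub)
  have l: "fsub_code (pr 0 1) 2 0 (fcode A) (fcode (flift A))" for A
    using fsub_code_tcode_iff[of "Var 1" 2 0] by (auto simp: flift_eq_sub)
  have ax: "derivable ?Ax inference x" if "logical_axiom x" for x
    using that by (blast intro: derivable.axiom)
  assume "PA \<union> E \<turnstile> A"
  then show "derivable ?Ax inference (fcode A)"
  proof induction
    case (Hyp A)
    then show ?case by (intro derivable.axiom) (auto simp: PA_axiom_iff)
  next
    case (MP A B)
    then show ?case by (intro derivable.step[OF _ MP.IH]) (auto simp: inference_def)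
  next
    case (Gen A)
    then show ?case by (intro derivable.step[OF _ Gen.IH Gen.IH]) (auto simp: inference_def)
  next
    case (AxK A B)
    show ?case by (rule ax) (use f[of A] f[of B] in \<open>auto simp: logical_axiom_def\<close>)
  next
    case (AxS A B C)
    show ?case by (rule ax) (use f[of A] f[of B] f[of C] in \<open>auto simp: logical_axiom_def\<close>)
  next
    case (AxDN A)
    show ?case by (rule ax) (use f[of A] in \<open>auto simp: logical_axiom_def\<close>)
  next
    case (AxInst A s)
    show ?case by (rule ax) (use i[of s A] in \<open>auto simp: logical_axiom_def\<close>)
  next
    case (AxDist A B)
    show ?case by (rule ax) (use f[of A] f[of B] in \<open>auto simp: logical_axiom_def\<close>)
  next
    case (AxVac A)
    show ?case by (rule ax) (use l[of A] in \<open>auto simp: logical_axiom_def\<close>)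
  next
    case (AxRefl s)
    show ?case by (rule ax) (use t[of s] in \<open>auto simp: logical_axiom_def\<close>)
  next
    case (AxLeibniz s u A)
    show ?case by (rule ax) (use i[of s A] i[of u A] in \<open>auto simp: logical_axiom_def\<close>)
  qed
next
  have "\<exists>A. x = fcode A \<and> PA \<union> E \<turnstile> A" if "derivable ?Ax inference x" for x
    using that
  proof induction
    case (axiom x)
    then show ?case
    proof (elim disjE)
      assume "logical_axiom x" then show ?thesis by (rule logical_axiom_sound)
    next
      assume "PA_axiom x" then show ?thesis by (auto simp: PA_axiom_iff intro: provable.Hyp)
    qed (auto intro: provable.Hyp)
  next
    case (step x y z)
    then obtain B C where y: "y = fcode B" "PA \<union> E \<turnstile> B" and z: "z = fcode C" "PA \<union> E \<turnstile> C" by blast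
    from step.hyps(1) show ?case
      unfolding inference_def
    proof
      assume "y = imp_code z x"
      with y z obtain D where "B = (C \<^bold>\<longrightarrow> D)" "x = fcode D"
        by (cases B) auto
      then show ?thesis using y z by (blast intro: provable.MP)
    next
      assume "x = all_code y"
      then show ?thesis using y by (intro exI[of _ "\<^bold>\<forall> B"]) (auto intro: provable.Gen)
    qed
  qed
  then show "derivable ?Ax inference (fcode A) \<Longrightarrow> PA \<union> E \<turnstile> A" by force
qed

text \<open>The added hypotheses vary with the environment. This uniformity is what lets one search
  run over the theories of all tuples.\<close>

lemma semidecidable_provable:
  assumes "semidecidable (\<lambda>e. \<exists>B\<in>E (\<lambda>i. e (Suc i)). e 0 = fcode B)"
  shows "semidecidable (\<lambda>e. PA \<union> E e \<turnstile> A)"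
  unfolding provable_iff_derivable
proof (intro semidecidable_derivable[where
    Ax = "\<lambda>x e. logical_axiom x \<or> PA_axiom x \<or> (\<exists>B\<in>E e. x = fcode B)" and
    Step = "\<lambda>x y z e. inference x y z"] semidecidable_disj assms computable_const)
  show "semidecidable (\<lambda>e. logical_axiom (e 0))"
    unfolding logical_axiom_def
    by (intro semidecidable_intros semidecidable_is_fcode semidecidable_is_tcode
        semidecidable_fsub_code computable_intros)
  show "semidecidable (\<lambda>e. PA_axiom (e 0))"
    unfolding PA_axiom_def
    by (intro semidecidable_intros semidecidable_fsub_code computable_intros)
  show "semidecidable (\<lambda>e. inference (e 0) (e (Suc 0)) (e (Suc (Suc 0))))"
    unfolding inference_def by (intro semidecidable_intros computable_intros)
qed

section \<open>Formulas computed from numerical parameters\<close>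

inductive trm_family :: "((nat \<Rightarrow> nat) \<Rightarrow> trm) \<Rightarrow> bool" where
  Var: "trm_family (\<lambda>e. Var i)"
| Zero: "trm_family (\<lambda>e. Zero)"
| Succ: "trm_family t \<Longrightarrow> trm_family (\<lambda>e. Succ (t e))"
| Plus: "trm_family t \<Longrightarrow> trm_family u \<Longrightarrow> trm_family (\<lambda>e. Plus (t e) (u e))"
| Times: "trm_family t \<Longrightarrow> trm_family u \<Longrightarrow> trm_family (\<lambda>e. Times (t e) (u e))"
| numeral: "computable F \<Longrightarrow> trm_family (\<lambda>e. numeral_trm (F e))"

lemma up_numeral_trm [simp]: "up k (numeral_trm n) = numeral_trm n"
  by (induction n) (auto simp: up_def)

lemma trm_family_up: "trm_family t \<Longrightarrow> trm_family (\<lambda>e. up k (t e))"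
proof (induction rule: trm_family.induct)
  case (numeral F)
  then show ?case by (simp add: trm_family.numeral)
qed (auto simp: up_def intro: trm_family.intros)

lemma computable_tcode: "trm_family t \<Longrightarrow> computable (\<lambda>e. tcode (t e))"
proof (induction rule: trm_family.induct)
  case (numeral F)
  have "tcode (numeral_trm n) = rec_nat (pr 1 0) (\<lambda>i h. pr 2 h) n" for n
    by (induction n) auto
  then show ?case
    by (simp only:) (intro computable_rec[where G = "\<lambda>i h e. pr 2 h"] computable_intros numeral)
qed (auto intro!: computable_intros)

text \<open>Formulas are only combined, so computability of the code is enough of an invariant.
  Terms are also shifted by \<open>up\<close>, which is why \<open>trm_family\<close> records how
  they are built.\<close>

definition fm_family :: "((nat \<Rightarrow> nat) \<Rightarrow> fm) \<Rightarrow> bool" where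
  "fm_family A \<longleftrightarrow> computable (\<lambda>e. fcode (A e))"

lemma fm_family_Eq: "trm_family t \<Longrightarrow> trm_family u \<Longrightarrow> fm_family (\<lambda>e. t e \<^bold>= u e)"
  by (auto simp: fm_family_def intro!: computable_intros computable_tcode)

lemma fm_family_Falsum: "fm_family (\<lambda>e. \<^bold>\<bottom>)"
  by (auto simp: fm_family_def intro!: computable_intros)

lemma fm_family_Imp: "fm_family A \<Longrightarrow> fm_family B \<Longrightarrow> fm_family (\<lambda>e. A e \<^bold>\<longrightarrow> B e)"
  by (auto simp: fm_family_def intro!: computable_intros)

lemma fm_family_Forall: "fm_family A \<Longrightarrow> fm_family (\<lambda>e. \<^bold>\<forall> (A e))"
  by (auto simp: fm_family_def intro!: computable_intros)

lemmas fm_family_basic =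
  fm_family_Eq fm_family_Falsum fm_family_Imp fm_family_Forall trm_family.intros trm_family_up

lemma fm_family_le_fm: "trm_family t \<Longrightarrow> trm_family u \<Longrightarrow> fm_family (\<lambda>e. le_fm (t e) (u e))"
  unfolding le_fm_def by (intro fm_family_basic)

lemma fm_family_less_fm: "trm_family t \<Longrightarrow> trm_family u \<Longrightarrow> fm_family (\<lambda>e. less_fm (t e) (u e))"
  unfolding less_fm_def by (intro fm_family_le_fm fm_family_basic)

lemma fm_family_beta_fm:
  "trm_family a \<Longrightarrow> trm_family b \<Longrightarrow> trm_family i \<Longrightarrow> trm_family v \<Longrightarrow>
   fm_family (\<lambda>e. beta_fm (a e) (b e) (i e) (v e))"
  unfolding beta_fm_def by (intro fm_family_le_fm fm_family_basic)

lemma fm_family_exs: "fm_family A \<Longrightarrow> fm_family (\<lambda>e. exs k (A e))"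
  by (induction k) (auto simp: exs_def intro!: fm_family_basic)

lemma fm_family_conjs:
  "(\<And>i. i \<in> set I \<Longrightarrow> fm_family (A i)) \<Longrightarrow> fm_family (\<lambda>e. conjs (map (\<lambda>i. A i e) I))"
  by (induction I) (auto simp: conjs_def intro!: fm_family_basic)

lemma trm_family_arg:
  "\<forall>t\<in>set ts. trm_family t \<Longrightarrow> trm_family (\<lambda>e. arg (map (\<lambda>t. t e) ts) i)"
  by (cases "i < length ts") (auto simp: arg_def intro: trm_family.intros)

text \<open>The program is fixed, so the induction on it takes place outside the coding; only the
  terms in \<open>ts\<close> and \<open>y\<close> depend on the environment.\<close>

lemma fm_family_graph:
  assumes "\<forall>t\<in>set ts. trm_family t" "trm_family y"
  shows "fm_family (\<lambda>e. graph f (map (\<lambda>t. t e) ts) (y e))"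
  using assms
proof (induction f arbitrary: ts y)
  case (Cn f gs)
  let ?k = "length gs"
  let ?ts = "map (\<lambda>t e. up ?k (t e)) ts"
  have "fm_family (\<lambda>e. conjs (map (\<lambda>i. graph (gs ! i) (map (\<lambda>t. t e) ?ts) (Var i)) [0..<?k]))"
    using Cn.prems
    by (intro fm_family_conjs Cn.IH(2)) (auto intro: fm_family_basic)
  moreover have "map2 (\<lambda>G i. G (map (up ?k) (map (\<lambda>t. t e) ts)) (Var i)) (map graph gs) [0..<?k] =
      map (\<lambda>i. graph (gs ! i) (map (\<lambda>t. t e) ?ts) (Var i)) [0..<?k]" for e
    by (rule nth_equalityI) (auto simp: comp_def)
  ultimately have "fm_family (\<lambda>e. conjs (map2 (\<lambda>G i. G (map (up ?k) (map (\<lambda>t. t e) ts)) (Var i))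
      (map graph gs) [0..<?k]))"
    by (simp only:)
  moreover have "fm_family (\<lambda>e. graph f (map Var [0..<?k]) (up ?k (y e)))"
  proof -
    have "fm_family (\<lambda>e. graph f (map (\<lambda>t. t e) (map (\<lambda>i e. Var i) [0..<?k])) (up ?k (y e)))"
      using Cn.prems by (intro Cn.IH(1)) (auto intro: fm_family_basic)
    then show ?thesis by (simp add: comp_def)
  qed
  ultimately show ?case
    unfolding graph.simps Let_def by (intro fm_family_exs fm_family_basic)
next
  case (Pr f g)
  have xs: "map (up k) (tl (map (\<lambda>t. t e) ts)) = map (\<lambda>t. t e) (map (\<lambda>t e. up k (t e)) (tl ts))" for k e
    by (simp add: map_tl comp_def)
  have ts: "\<forall>t\<in>set (map (\<lambda>t e. up k (t e)) (tl ts)). trm_family t" for k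
    using Pr.prems(1) by (cases ts) (auto intro!: trm_family_up)
  have "fm_family (\<lambda>e. graph f (map (up 3) (tl (map (\<lambda>t. t e) ts))) (Var 0))"
    unfolding xs by (intro Pr.IH(1) ts fm_family_basic)
  moreover
  have "fm_family (\<lambda>e. graph g (map (\<lambda>t. t e) ((\<lambda>e. Var 2) # (\<lambda>e. Var 1) # map (\<lambda>t e. up 5 (t e)) (tl ts))) (Var 0))"
    using ts by (intro Pr.IH(2)) (auto intro: fm_family_basic)
  then have "fm_family (\<lambda>e. graph g (Var 2 # Var 1 # map (up 5) (tl (map (\<lambda>t. t e) ts))) (Var 0))"
    unfolding xs by simp
  ultimately show ?case
    unfolding graph.simps Let_def using Pr.prems
    by (intro fm_family_basic fm_family_beta_fm fm_family_less_fm trm_family_arg)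
next
  case (Mn f)
  have "fm_family (\<lambda>e. graph f (map (\<lambda>t. t e) (y # ts)) Zero)"
    using Mn.prems by (intro Mn.IH) (auto intro: fm_family_basic)
  moreover
  have "fm_family (\<lambda>e. graph f (map (\<lambda>t. t e) ((\<lambda>e. Var 1) # map (\<lambda>t e. up 2 (t e)) ts)) (Succ (Var 0)))"
    using Mn.prems by (intro Mn.IH) (auto intro!: fm_family_basic)
  ultimately show ?case
    unfolding graph.simps using Mn.prems
    by (intro fm_family_basic fm_family_less_fm) (simp_all add: comp_def)
qed (auto intro!: fm_family_basic trm_family_arg)

lemma fm_family_length_fm:
  assumes "trm_family p" "trm_family k" shows "fm_family (\<lambda>e. length_fm (p e) (k e))"
proof -
  have "fm_family (\<lambda>e. graph pow2_recf (map (\<lambda>t. t e) [\<lambda>e. up 1 (k e)]) (Var 0))"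
    using assms by (intro fm_family_graph) (auto intro: fm_family_basic)
  then show ?thesis
    unfolding length_fm_def using assms
    by (intro fm_family_basic fm_family_le_fm fm_family_less_fm) simp_all
qed

lemma fm_family_complexity_fm:
  assumes "trm_family x" "trm_family v" shows "fm_family (\<lambda>e. complexity_fm D (x e) (v e))"
proof -
  have "fm_family (\<lambda>e. graph D (map (\<lambda>t. t e) [\<lambda>e. Var i]) (up k (x e)))" for i k
    using assms by (intro fm_family_graph) (auto intro: fm_family_basic)
  then show ?thesis
    unfolding complexity_fm_def using assms
    by (intro fm_family_basic fm_family_le_fm fm_family_length_fm) simp_all
qed

lemma fm_family_complexity_ge_fm:
  assumes "trm_family x" "trm_family k" shows "fm_family (\<lambda>e. complexity_ge_fm D (x e) (k e))"
  unfolding complexity_ge_fm_def using assms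
  by (intro fm_family_basic fm_family_le_fm fm_family_complexity_fm)


section \<open>Kolmogorov complexity in the standard model\<close>

abbreviation string_length :: "nat \<Rightarrow> nat" where
  "string_length p \<equiv> floor_log (Suc p)"

lemma reval_Cn1: "reval g xs z \<Longrightarrow> reval f [z] y \<Longrightarrow> reval (Cn f [g]) xs y"
  using reval_Cn_intro[of 1 "\<lambda>_. g" xs "\<lambda>_. z" f y] by simp

lemma reval_Cn2:
  "reval g xs z \<Longrightarrow> reval h xs w \<Longrightarrow> reval f [z, w] y \<Longrightarrow> reval (Cn f [g, h]) xs y"
  unfolding reval.simps by (rule exI[of _ "[z, w]"]) simp

lemma reval_Pr_intro:
  assumes "reval f xs (s 0)" "\<And>i. reval g (i # s i # xs) (s (Suc i))"
  shows "reval (Pr f g) (n # xs) (s n)"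
  unfolding reval.simps by (rule exI[of _ s]) (simp add: assms narg_def)

lemma reval_add_recf: "reval add_recf [a, b] (a + b)"
  unfolding add_recf_def
proof (rule reval_Pr_intro[where s = "\<lambda>i. i + b"])
  show "reval (Cn Sc [Pj 1]) [i, i + b, b] (Suc i + b)" for i
    by (rule reval_Cn1[where z = "i + b"]) (simp_all add: narg_def)
qed (simp add: narg_def)

lemma reval_pow2_recf: "reval pow2_recf [k] y \<longleftrightarrow> y = 2 ^ k"
proof -
  have "reval pow2_recf [k] (2 ^ k)"
    unfolding pow2_recf_def
  proof (rule reval_Pr_intro[where s = "\<lambda>i. 2 ^ i"])
    show "reval (Cn Sc [Zr]) [] (2 ^ 0)"
      by (rule reval_Cn1[where z = 0]) (simp_all add: narg_def)
    fix i
    have "reval add_recf [2 ^ i, 2 ^ i] (2 ^ Suc i)"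
      using reval_add_recf[of "2 ^ i" "2 ^ i"] by (simp add: mult_2)
    then show "reval (Cn add_recf [Pj 1, Pj 1]) [i, 2 ^ i] (2 ^ Suc i)"
      by (rule reval_Cn2[rotated 2]) (simp_all add: narg_def)
  qed
  then show ?thesis using reval_unique by blast
qed

lemma sat_length_fm [simp]: "sat e (length_fm p k) \<longleftrightarrow> string_length (tval e p) = tval e k"
proof -
  have "2 ^ v \<le> Suc n \<and> Suc n < 2 ^ v + 2 ^ v \<longleftrightarrow> floor_log (Suc n) = v" for n v :: nat
    using floor_log_exp2_le[of "Suc n"] floor_log_exp2_gt[of "Suc n"] floor_log_eqI[of "Suc n" v] by auto
  then show ?thesis by (simp add: length_fm_def sat_graph reval_pow2_recf)
qed

lemma tval_up_2 [simp]: "tval (case_nat x (case_nat y e)) (up 2 t) = tval e t"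
  by (simp add: tval_up numeral_eq_Suc)

lemma sat_complexity_fm:
  "sat e (complexity_fm D x v) \<longleftrightarrow>
     (\<exists>p. reval D [p] (tval e x) \<and> string_length p = tval e v) \<and>
     (\<forall>p. reval D [p] (tval e x) \<longrightarrow> tval e v \<le> string_length p)"
  by (auto simp: complexity_fm_def sat_graph)

lemma shortest_description:
  assumes "reval D [p] x"
  obtains q where "reval D [q] x" "string_length q \<le> string_length p"
    "\<And>r. reval D [r] x \<Longrightarrow> string_length q \<le> string_length r"
  using that[of "arg_min string_length (\<lambda>q. reval D [q] x)"]
    arg_min_natI[of "\<lambda>q. reval D [q] x" p string_length]
    arg_min_nat_le[of "\<lambda>q. reval D [q] x" _ string_length] assms
  by blast

text \<open>The formula speaks of the exact value of the complexity, the right-hand side of all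
  descriptions; a shortest description mediates. Without any description both sides hold
  vacuously.\<close>

lemma sat_complexity_ge_fm:
  "sat e (complexity_ge_fm D x k) \<longleftrightarrow>
     (\<forall>p. reval D [p] (tval e x) \<longrightarrow> tval e k \<le> string_length p)"
proof -
  have "sat e (complexity_ge_fm D x k) \<longleftrightarrow>
    (\<forall>v. (\<exists>p. reval D [p] (tval e x) \<and> string_length p = v) \<and>
     (\<forall>p. reval D [p] (tval e x) \<longrightarrow> v \<le> string_length p) \<longrightarrow> tval e k \<le> v)"
    by (simp add: complexity_ge_fm_def sat_complexity_fm)
  also have "\<dots> \<longleftrightarrow> (\<forall>p. reval D [p] (tval e x) \<longrightarrow> tval e k \<le> string_length p)"
    (is "?L \<longleftrightarrow> ?R")
  proof
    assume L: ?L
    show ?R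
    proof (intro allI impI)
      fix p assume "reval D [p] (tval e x)"
      from shortest_description[OF this] obtain q where q: "reval D [q] (tval e x)"
        "string_length q \<le> string_length p"
        "\<And>r. reval D [r] (tval e x) \<Longrightarrow> string_length q \<le> string_length r" by blast
      then have "tval e k \<le> string_length q" using L by blast
      then show "tval e k \<le> string_length p" using q(2) by simp
    qed
  qed blast
  finally show ?thesis .
qed

text \<open>The proved inequality compares minimal lengths, so it is applied to a shortest
  description for \<open>D'\<close>; the bound for an arbitrary description \<open>p\<close>
  follows.\<close>

lemma provably_optimal_imp_optimal:
  assumes "provably_optimal D"
  shows "\<exists>c. \<forall>p x. reval D' [p] x \<longrightarrow> (\<exists>q. reval D [q] x \<and> string_length q \<le> string_length p + c)"
proof -
  obtain c where c: "PA \<turnstile> dominates_fm D D' c"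
    using assms by (auto simp: provably_optimal_def)
  have "\<exists>q. reval D [q] x \<and> string_length q \<le> string_length p + c" if "reval D' [p] x" for p x
  proof -
    obtain q where q: "reval D' [q] x" "string_length q \<le> string_length p"
      "\<And>r. reval D' [r] x \<Longrightarrow> string_length q \<le> string_length r"
      using shortest_description[OF \<open>reval D' [p] x\<close>] by blast
    have "sat (\<lambda>_. 0) (dominates_fm D D' c)" by (rule soundness[OF c sat_PA])
    then have "sat (case_nat (string_length q) (case_nat x (\<lambda>_. 0)))
        (complexity_fm D' (Var 1) (Var 0) \<^bold>\<longrightarrow>
          \<^bold>\<exists> (complexity_fm D (Var 2) (Var 0) \<^bold>\<and> le_fm (Var 0) (Plus (Var 1) (numeral_trm c))))"
      unfolding dominates_fm_def sat.simps(4) by blast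
    then show ?thesis using q by (fastforce simp: sat_complexity_fm)
  qed
  then show ?thesis by blast
qed

text \<open>A description determines what it describes, and in the length-lexicographic numbering
  the descriptions shorter than \<open>k\<close> are numbers below \<open>2 ^ k\<close>.\<close>

lemma card_short_descriptions:
  "finite {x. \<exists>p. reval D [p] x \<and> string_length p < k}"
  "card {x. \<exists>p. reval D [p] x \<and> string_length p < k} \<le> 2 ^ k"
proof -
  let ?f = "\<lambda>p. THE x. reval D [p] x"
  have "Suc p < 2 ^ k" if "string_length p < k" for p
  proof -
    have "Suc p < 2 ^ Suc (string_length p)" using floor_log_exp2_gt[of "Suc p"] by simp
    also have "\<dots> \<le> 2 ^ k" using that by (intro power_increasing) auto
    finally show ?thesis .
  qed
  moreover have "?f p = x" if "reval D [p] x" for p x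
    using that reval_unique by blast
  ultimately have *: "{x. \<exists>p. reval D [p] x \<and> string_length p < k} \<subseteq> ?f ` {..<2 ^ k}"
    by (force intro: Suc_lessD)
  then show "finite {x. \<exists>p. reval D [p] x \<and> string_length p < k}"
    by (rule finite_subset) simp
  have "card (?f ` {..<2 ^ k}) \<le> card {..<2 ^ k :: nat}" by (rule card_image_le) simp
  then show "card {x. \<exists>p. reval D [p] x \<and> string_length p < k} \<le> 2 ^ k"
    using card_mono[OF _ *] by simp
qed

section \<open>Coding tuples of strings\<close>

abbreviation strings :: "nat \<Rightarrow> bool list set" where
  "strings n \<equiv> {w. length w = n}"

abbreviation string_tuples :: "nat \<Rightarrow> nat \<Rightarrow> (nat \<Rightarrow> bool list) set" where
  "string_tuples m n \<equiv> PiE_dflt {..<m} [] (\<lambda>_. strings n)"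

text \<open>The codes of the strings of length \<open>n\<close> start at \<open>2 ^ n - 1\<close>,
  so this is the code of the string selected by digit \<open>i\<close> of \<open>a\<close> in base
  \<open>2 ^ n\<close>. A single number \<open>a\<close> thus stands for a whole tuple.\<close>

definition string_digit :: "nat \<Rightarrow> nat \<Rightarrow> nat \<Rightarrow> nat" where
  "string_digit n a i = 2 ^ n - 1 + a div (2 ^ n) ^ i mod 2 ^ n"

lemma string_code_snoc: "string_code (w @ [b]) = 2 * string_code w + (if b then 2 else 1)"
  by (simp add: string_code_def)

lemma string_code_bounds: "2 ^ length w \<le> Suc (string_code w)" "Suc (string_code w) < 2 * 2 ^ length w"
  by (induction w rule: rev_induct) (auto simp: string_code_snoc string_code_def[of "[]"])

lemma string_code_inject: "length v = length w \<Longrightarrow> string_code v = string_code w \<Longrightarrow> v = w"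
proof (induction v arbitrary: w rule: rev_induct)
  case (snoc b v)
  then obtain w' b' where w: "w = w' @ [b']"
    by (metis length_0_conv length_append_singleton nat.simps(3) rev_exhaust)
  have "string_code v = string_code w' \<and> b = b'"
    using snoc.prems(2) unfolding w string_code_snoc by (auto split: if_splits; presburger)
  then show ?case using snoc.IH snoc.prems(1) w by simp
qed simp

lemma finite_strings: "finite (strings n)"
  using finite_lists_length_eq[of "UNIV :: bool set" n] by simp

lemma card_strings: "card (strings n) = 2 ^ n"
  using card_lists_length_eq[of "UNIV :: bool set" n] by simp

lemma bij_betw_string_code: "bij_betw string_code (strings n) {2 ^ n - 1..<2 ^ n - 1 + 2 ^ n}"
proof -
  have inj: "inj_on string_code (strings n)"
    by (auto intro!: inj_onI string_code_inject)
  have "string_code ` strings n \<subseteq> {2 ^ n - 1..<2 ^ n - 1 + 2 ^ n}"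
  proof
    fix x assume "x \<in> string_code ` strings n"
    then obtain w where "x = string_code w" "length w = n" by auto
    then show "x \<in> {2 ^ n - 1..<2 ^ n - 1 + 2 ^ n}" using string_code_bounds[of w] by auto
  qed
  then have "string_code ` strings n = {2 ^ n - 1..<2 ^ n - 1 + 2 ^ n}"
    by (intro card_subset_eq) (simp_all add: card_image[OF inj] card_strings)
  with inj show ?thesis by (simp add: bij_betw_def)
qed

lemma finite_string_tuples: "finite (string_tuples m n)"
  by (intro finite_PiE_dflt finite_strings) auto

lemma card_string_tuples: "card (string_tuples m n) = 2 ^ (n * m)"
  by (subst card_PiE_dflt) (auto simp: finite_strings card_strings power_mult)

lemma digits_inject:
  fixes B :: nat
  assumes "a < B ^ m" "a' < B ^ m" "\<And>i. i < m \<Longrightarrow> a div B ^ i mod B = a' div B ^ i mod B"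
  shows "a = a'"
  using assms
proof (induction m arbitrary: a a')
  case (Suc m)
  have "a div B = a' div B"
  proof (rule Suc.IH)
    show "a div B < B ^ m" "a' div B < B ^ m"
      using Suc.prems(1,2) by (auto simp: less_mult_imp_div_less mult.commute)
    show "a div B div B ^ i mod B = a' div B div B ^ i mod B" if "i < m" for i
      using Suc.prems(3)[of "Suc i"] that by (simp add: div_mult2_eq)
  qed
  moreover have "a mod B = a' mod B" using Suc.prems(3)[of 0] by simp
  ultimately show ?case by (metis div_mult_mod_eq)
qed simp

text \<open>The default \<open>[]\<close> from index \<open>m\<close> on agrees with that of the
  product distribution, so that the numbering can be a bijection onto its support.\<close>

definition tuple_of_nat :: "nat \<Rightarrow> nat \<Rightarrow> nat \<Rightarrow> nat \<Rightarrow> bool list" where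
  "tuple_of_nat m n a i =
     (if i < m then inv_into (strings n) string_code (string_digit n a i) else [])"

lemma string_digit_in: "string_digit n a i \<in> {2 ^ n - 1..<2 ^ n - 1 + 2 ^ n}"
  unfolding string_digit_def atLeastLessThan_iff by (intro conjI le_add1 add_strict_left_mono) simp

lemma string_code_tuple_of_nat: "i < m \<Longrightarrow> string_code (tuple_of_nat m n a i) = string_digit n a i"
  using string_digit_in[of n a i] bij_betw_string_code[of n]
  by (auto simp: tuple_of_nat_def bij_betw_def f_inv_into_f)

lemma tuple_of_nat_in: "tuple_of_nat m n a \<in> string_tuples m n"
proof -
  have "inv_into (strings n) string_code (string_digit n a i) \<in> strings n" for i
    using string_digit_in[of n a i] bij_betw_string_code[of n]
    by (intro inv_into_into) (simp add: bij_betw_def)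
  then show ?thesis by (simp add: PiE_dflt_def tuple_of_nat_def)
qed

lemma bij_betw_tuple_of_nat: "bij_betw (tuple_of_nat m n) {..<2 ^ (n * m)} (string_tuples m n)"
proof -
  have inj: "inj_on (tuple_of_nat m n) {..<2 ^ (n * m)}"
  proof (rule inj_onI)
    fix a a' assume a: "a \<in> {..<2 ^ (n * m)}" "a' \<in> {..<2 ^ (n * m)}"
      and eq: "tuple_of_nat m n a = tuple_of_nat m n a'"
    have "string_digit n a i = string_digit n a' i" if "i < m" for i
      using string_code_tuple_of_nat[OF that] eq by metis
    then have "a div (2 ^ n) ^ i mod 2 ^ n = a' div (2 ^ n) ^ i mod 2 ^ n" if "i < m" for i
      using that unfolding string_digit_def add_left_cancel by blast
    then show "a = a'"
      using a by (intro digits_inject[of a "2 ^ n" m]) (simp_all add: power_mult)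
  qed
  have "tuple_of_nat m n ` {..<2 ^ (n * m)} = string_tuples m n"
    by (intro card_subset_eq)
       (auto simp: card_image[OF inj] card_string_tuples finite_string_tuples tuple_of_nat_in)
  with inj show ?thesis by (simp add: bij_betw_def)
qed


section \<open>Counting the inconsistent tuples\<close>

text \<open>The theory depends on numbers \<open>X i\<close> rather than on strings, so that its
  members are computable families of formulas.\<close>

definition signed :: "recf \<Rightarrow> nat \<Rightarrow> (nat \<Rightarrow> bool) \<Rightarrow> nat \<Rightarrow> (nat \<Rightarrow> nat) \<Rightarrow> fm set" where
  "signed D m b k X = (\<lambda>i. if b i then complexity_ge_fm D (numeral_trm (X i)) (numeral_trm k)
     else \<^bold>\<not> complexity_ge_fm D (numeral_trm (X i)) (numeral_trm k)) ` {..<m}"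

text \<open>The two parts of a tuple are represented by full tuples: all counts then range over the
  same set, and exchanging coordinates is an involution.\<close>

definition merge :: "(nat \<Rightarrow> bool) \<Rightarrow> (nat \<Rightarrow> 'a) \<Rightarrow> (nat \<Rightarrow> 'a) \<Rightarrow> nat \<Rightarrow> 'a" where
  "merge b f g i = (if b i then f i else g i)"

lemma semidecidable_ex_bounded:
  "(\<And>i. semidecidable (P i)) \<Longrightarrow> semidecidable (\<lambda>e. \<exists>i<m. P i e)" for m :: nat
proof (induction m)
  case (Suc m)
  then have "semidecidable (\<lambda>e. P m e \<or> (\<exists>i<m. P i e))" by (intro semidecidable_disj) blast+
  also have "(\<lambda>e. P m e \<or> (\<exists>i<m. P i e)) = (\<lambda>e. \<exists>i<Suc m. P i e)"
    by (auto simp: less_Suc_eq)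
  finally show ?case .
qed (simp add: semidecidable_const)

lemma semidecidable_inconsistent:
  assumes "\<And>i. computable (X i)" "computable k"
  shows "semidecidable (\<lambda>e. \<not> consistent (PA \<union> signed D m b (k e) (\<lambda>i. X i e)))"
proof -
  have "computable (\<lambda>e. fcode (complexity_ge_fm D (numeral_trm (X i (\<lambda>i. e (Suc i))))
      (numeral_trm (k (\<lambda>i. e (Suc i))))))" for i
    unfolding fm_family_def[symmetric]
    by (intro fm_family_complexity_ge_fm trm_family.numeral computable_comp[OF assms(1)]
        computable_comp[OF assms(2)] computable_intros)
  note code = this
  let ?P = "\<lambda>i e. e 0 = fcode (if b i
      then complexity_ge_fm D (numeral_trm (X i (\<lambda>i. e (Suc i)))) (numeral_trm (k (\<lambda>i. e (Suc i))))
      else \<^bold>\<not> complexity_ge_fm D (numeral_trm (X i (\<lambda>i. e (Suc i)))) (numeral_trm (k (\<lambda>i. e (Suc i)))))"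
  have "semidecidable (?P i)" for i
    by (cases "b i") (auto intro!: semidecidable_intros computable_intros code)
  then have "semidecidable (\<lambda>e. \<exists>i<m. ?P i e)" by (rule semidecidable_ex_bounded)
  then have "semidecidable (\<lambda>e. \<exists>B\<in>signed D m b (k (\<lambda>i. e (Suc i))) (\<lambda>j. X j (\<lambda>i. e (Suc i))). e 0 = fcode B)"
    by (simp only: signed_def bex_simps) (simp only: Bex_def lessThan_iff)
  then show ?thesis
    unfolding consistent_def not_not by (rule semidecidable_provable)
qed

lemma card_tuples_coordinate:
  assumes "i < m" "S \<subseteq> strings n"
  shows "card {f \<in> string_tuples m n. f i \<in> S} = card S * (2 ^ n) ^ (m - 1)"
proof -
  have "{f \<in> string_tuples m n. f i \<in> S} = PiE_dflt {..<m} [] (\<lambda>j. if j = i then S else strings n)"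
    using assms by (auto simp: PiE_dflt_def split: if_splits)
  moreover have "finite S" using assms(2) finite_strings by (rule finite_subset)
  ultimately have "card {f \<in> string_tuples m n. f i \<in> S} = (\<Prod>j<m. card (if j = i then S else strings n))"
    by (simp add: card_PiE_dflt finite_strings)
  also have "\<dots> = card S * (\<Prod>j\<in>{..<m} - {i}. card (if j = i then S else strings n))"
    using assms(1) by (subst prod.remove[of _ i]) auto
  also have "(\<Prod>j\<in>{..<m} - {i}. card (if j = i then S else strings n)) = (\<Prod>j\<in>{..<m} - {i}. 2 ^ n)"
    by (intro prod.cong) (auto simp: card_strings)
  finally show ?thesis using assms(1) by simp
qed

lemma eventually_floor_log_less: "\<forall>\<^sub>F n in sequentially. floor_log (Suc n) + C + c < n"
proof (intro eventually_sequentiallyI leI)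
  fix n assume n: "2 * (C + c) + 2 \<le> n"
  show "floor_log (Suc n) + C + c < n"
  proof (rule ccontr)
    assume neg: "\<not> ?thesis"
    \<comment> \<open>If the claim fails, then \<open>2 * 2 ^ k \<le> Suc n\<close>. The crude bound
      \<open>k + 1 \<le> 2 ^ k\<close> turns this into \<open>2 * (n - C - c) \<le> n + 1\<close>,
      against the choice of \<open>n\<close>.\<close>
    define k where "k = n - C - c - 1"
    have "k + 1 \<le> floor_log (Suc n)" using neg n by (simp add: k_def)
    then have "2 ^ (k + 1) \<le> (2::nat) ^ floor_log (Suc n)" by (rule power_increasing) simp
    also have "\<dots> \<le> Suc n" by (rule floor_log_exp2_le) simp
    finally have "2 * 2 ^ k \<le> Suc n" by simp
    moreover have "k + 1 \<le> 2 ^ k" using less_exp[of k] by (simp add: Suc_le_eq)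
    ultimately show False using n by (simp add: k_def)
  qed
qed

text \<open>
  By pigeonhole a frequent inconsistency is frequent for some fixed \<open>g\<close>.  Such a \<open>g\<close> can be found
  by enumerating proofs, so its components are simple, while most \<open>f\<close> have incompressible
  components: the standard model satisfies the theories that were claimed to be inconsistent.
\<close>

lemma eventually_few_inconsistent_extensions:
  assumes "provably_optimal D"
  shows "\<forall>\<^sub>F n in sequentially. \<forall>g\<in>string_tuples m n.
     2 ^ c * card {f \<in> string_tuples m n.
       \<not> consistent (PA \<union> signed D m b (n - c) (\<lambda>i. string_code (merge b f g i)))} \<le> m * 2 ^ (n * m)"
proof -
  \<comment> \<open>The number \<open>a\<close> stands for the tuple \<open>f\<close> and
    \<open>y\<close> for the tuple \<open>g\<close>.\<close>
  define bad where "bad n y a \<longleftrightarrow>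
    \<not> consistent (PA \<union> signed D m b (n - c) (\<lambda>i. string_digit n (if b i then a else y) i))" for n y a
  \<comment> \<open>More than a fraction \<open>m / 2 ^ c\<close> of all \<open>a\<close> is
    inconsistent with \<open>y\<close>. Rounding down and adding 1 gives an integer lower bound on a
    count, the form that can be searched for.\<close>
  define R where "R y n \<longleftrightarrow> Suc (m * 2 ^ (n * m) div 2 ^ c) \<le> card {a. a < 2 ^ (n * m) \<and> bad n y a}" for y n
  have "semidecidable (\<lambda>e. R (e 0) (e (Suc 0)))"
    unfolding R_def bad_def string_digit_def
    by (intro semidecidable_card[where P = "\<lambda>a e. \<not> consistent (PA \<union> signed D m b (e (Suc 0) - c)
          (\<lambda>i. 2 ^ e (Suc 0) - 1 + (if b i then a else e 0) div (2 ^ e (Suc 0)) ^ i mod 2 ^ e (Suc 0)))"]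
        semidecidable_inconsistent computable_intros)
  from semidecidable_uniformize[OF this]
  obtain r where r: "\<And>n y. R y n \<Longrightarrow> \<exists>y. R y n \<and> reval r [n] y" by blast
  \<comment> \<open>The program \<open>d j\<close> reads off component \<open>j\<close> of the tuple
    numbered \<open>y\<close>. Composed with \<open>r\<close> it becomes a fixed program with input
    \<open>n\<close>, so the constants from optimality do not depend on \<open>n\<close>.\<close>
  have "\<exists>d. \<forall>xs. reval d xs (string_digit (narg xs 1) (narg xs 0) j)" for j
  proof -
    have "computable (\<lambda>e. string_digit (e 1) (e 0) j)"
      unfolding string_digit_def by (intro computable_intros)
    then show ?thesis by (rule computable_reval_narg)
  qed
  then obtain d where d: "\<And>j xs. reval (d j) xs (string_digit (narg xs 1) (narg xs 0) j)" by metis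
  have "reval (Cn (d j) [r, Pj 0]) [n] (string_digit n y j)" if "reval r [n] y" for j n y
    using that d[of j "[y, n]"] by (intro reval_Cn2[where z = y and w = n]) (simp_all add: narg_def)
  moreover have "\<forall>j. \<exists>C. \<forall>p x. reval (Cn (d j) [r, Pj 0]) [p] x \<longrightarrow>
      (\<exists>q. reval D [q] x \<and> string_length q \<le> string_length p + C)"
    using provably_optimal_imp_optimal[OF assms] by blast
  from choice[OF this] obtain C where "\<And>j p x. reval (Cn (d j) [r, Pj 0]) [p] x \<Longrightarrow>
      \<exists>q. reval D [q] x \<and> string_length q \<le> string_length p + C j"
    by blast
  ultimately have simple: "\<exists>q. reval D [q] (string_digit n y j) \<and> string_length q \<le> string_length n + C j"
    if "reval r [n] y" for j n y
    using that by blast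
  define C' where "C' = (\<Sum>j<m. C j)"
  have "\<forall>g\<in>string_tuples m n. 2 ^ c * card {f \<in> string_tuples m n.
       \<not> consistent (PA \<union> signed D m b (n - c) (\<lambda>i. string_code (merge b f g i)))} \<le> m * 2 ^ (n * m)"
    if n: "string_length n + C' + c < n" for n
  proof (rule ccontr)
    let ?N = "\<lambda>g. {f \<in> string_tuples m n.
       \<not> consistent (PA \<union> signed D m b (n - c) (\<lambda>i. string_code (merge b f g i)))}"
    have sig: "signed D m b k (\<lambda>i. string_code (merge b (tuple_of_nat m n a) (tuple_of_nat m n y) i)) =
        signed D m b k (\<lambda>i. string_digit n (if b i then a else y) i)" for a y k
      unfolding signed_def by (intro image_cong) (auto simp: merge_def string_code_tuple_of_nat)
    have N: "?N (tuple_of_nat m n y) = tuple_of_nat m n ` {a. a < 2 ^ (n * m) \<and> bad n y a}" for y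
    proof -
      have "string_tuples m n = tuple_of_nat m n ` {..<2 ^ (n * m)}"
        using bij_betw_tuple_of_nat[of m n] by (simp add: bij_betw_def)
      then show ?thesis by (auto simp: bad_def sig)
    qed
    have card_N: "card (?N (tuple_of_nat m n y)) = card {a. a < 2 ^ (n * m) \<and> bad n y a}" for y
      unfolding N
      by (intro card_image inj_on_subset[OF bij_betw_imp_inj_on[OF bij_betw_tuple_of_nat]]) auto
    have R_iff: "R y n \<longleftrightarrow> m * 2 ^ (n * m) < 2 ^ c * card (?N (tuple_of_nat m n y))" for y
      unfolding R_def card_N Suc_le_eq by (simp add: div_less_iff_less_mult mult.commute)
    assume "\<not> (\<forall>g\<in>string_tuples m n. 2 ^ c * card (?N g) \<le> m * 2 ^ (n * m))"
    then obtain g where g: "g \<in> string_tuples m n" "m * 2 ^ (n * m) < 2 ^ c * card (?N g)"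
      by (auto simp: not_le)
    then obtain y0 where "g = tuple_of_nat m n y0"
      using bij_betw_tuple_of_nat[of m n] by (auto simp: bij_betw_def)
    then have "R y0 n" using g(2) R_iff by simp
    \<comment> \<open>\<open>y0\<close> guarantees that the search succeeds. The \<open>y\<close> it
      returns may differ from \<open>y0\<close>, but satisfies \<open>R\<close> as well and is
      computed from \<open>n\<close>.\<close>
    then obtain y where y: "R y n" "reval r [n] y" using r by blast
    define F where "F = {x. \<exists>p. reval D [p] x \<and> string_length p < n - c}"
    have y_F: "string_digit n y j \<in> F" if "j < m" for j
    proof -
      obtain q where q: "reval D [q] (string_digit n y j)" "string_length q \<le> string_length n + C j"
        using simple[OF y(2)] by blast
      have "C j \<le> C'" unfolding C'_def using that by (intro member_le_sum) auto
      then have "string_length q < n - c" using q(2) n by simp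
      then show ?thesis using q(1) by (auto simp: F_def)
    qed
    let ?S = "{w \<in> strings n. string_code w \<in> F}"
    \<comment> \<open>If no component of \<open>f\<close> has its code in \<open>F\<close>, the
      standard model satisfies the whole theory: the unnegated statements by this assumption, the
      negated ones by \<open>y_F\<close>. So an inconsistent \<open>f\<close> has a compressible
      component.\<close>
    have "?N (tuple_of_nat m n y) \<subseteq> (\<Union>i<m. {f \<in> string_tuples m n. f i \<in> ?S})"
    proof
      fix f assume f: "f \<in> ?N (tuple_of_nat m n y)"
      have "\<exists>i<m. string_code (f i) \<in> F"
      proof (rule ccontr)
        assume *: "\<not> ?thesis"
        have "consistent (PA \<union> signed D m b (n - c) (\<lambda>i. string_code (merge b f (tuple_of_nat m n y) i)))"
        proof (rule sat_theory_consistent, elim UnE)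
          fix B e
          assume "B \<in> signed D m b (n - c) (\<lambda>i. string_code (merge b f (tuple_of_nat m n y) i))"
          then show "sat e B"
            using * y_F
            by (auto simp: signed_def merge_def sat_complexity_ge_fm string_code_tuple_of_nat F_def not_less)
               (meson not_le)+
        qed (rule sat_PA)
        then show False using f by simp
      qed
      then obtain i where i: "i < m" "string_code (f i) \<in> F" by blast
      then have "f i \<in> ?S" using f by (auto simp: PiE_dflt_def)
      then show "f \<in> (\<Union>i<m. {f \<in> string_tuples m n. f i \<in> ?S})" using f i(1) by blast
    qed
    then have "card (?N (tuple_of_nat m n y)) \<le> card (\<Union>i<m. {f \<in> string_tuples m n. f i \<in> ?S})"
      by (intro card_mono finite_UN_I) (auto simp: finite_string_tuples)
    also have "\<dots> \<le> (\<Sum>i<m. card {f \<in> string_tuples m n. f i \<in> ?S})"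
      by (intro card_UN_le) simp
    also have "\<dots> \<le> (\<Sum>i<m. 2 ^ (n - c) * (2 ^ n) ^ (m - 1))"
    proof (rule sum_mono)
      fix i assume "i \<in> {..<m}"
      have "card ?S = card (string_code ` ?S)"
        by (intro card_image[symmetric]) (auto intro!: inj_onI string_code_inject)
      also have "\<dots> \<le> card F"
        unfolding F_def by (intro card_mono card_short_descriptions) auto
      also have "\<dots> \<le> 2 ^ (n - c)" unfolding F_def by (rule card_short_descriptions)
      finally have "card ?S \<le> 2 ^ (n - c)" .
      then show "card {f \<in> string_tuples m n. f i \<in> ?S} \<le> 2 ^ (n - c) * (2 ^ n) ^ (m - 1)"
        using \<open>i \<in> {..<m}\<close> by (subst card_tuples_coordinate) auto
    qed
    also have "\<dots> = m * (2 ^ (n - c) * (2 ^ n) ^ (m - 1))" by simp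
    finally have "2 ^ c * card (?N (tuple_of_nat m n y)) \<le> m * (2 ^ c * 2 ^ (n - c) * (2 ^ n) ^ (m - 1))"
      by (simp add: mult_ac)
    also have "\<dots> = m * 2 ^ (n * m)"
    \<comment> \<open>For \<open>m = 0\<close> both sides vanish; otherwise the exponents add up to
      \<open>n * m\<close>, where \<open>c \<le> n\<close> makes the subtraction
      \<open>n - c\<close> exact.\<close>
    proof (cases m)
      case (Suc m')
      have "2 ^ c * 2 ^ (n - c) = (2::nat) ^ n" using n by (simp flip: power_add)
      then show ?thesis using Suc by (simp add: power_mult power_add)
    qed simp
    finally show False using y(1) R_iff by simp
  qed
  then show ?thesis
    using eventually_floor_log_less[of C' c] by (auto elim!: eventually_mono)
qed

text \<open>The bound is averaged over \<open>g\<close>. A pair \<open>(g, f)\<close> amounts to the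
  tuple \<open>merge b f g\<close> together with the remaining coordinates
  \<open>merge b g f\<close>, so every tuple is counted equally often.\<close>

lemma eventually_few_inconsistent:
  assumes "provably_optimal D"
  shows "\<forall>\<^sub>F n in sequentially.
     2 ^ c * card {x \<in> string_tuples m n.
       \<not> consistent (PA \<union> signed D m b (n - c) (\<lambda>i. string_code (x i)))} \<le> m * 2 ^ (n * m)"
  using eventually_few_inconsistent_extensions[OF assms, of m c b]
proof (rule eventually_mono)
  fix n
  let ?T = "string_tuples m n"
  let ?bad = "\<lambda>x. \<not> consistent (PA \<union> signed D m b (n - c) (\<lambda>i. string_code (x i)))"
  let ?X = "{x \<in> ?T. ?bad x}"
  assume *: "\<forall>g\<in>?T. 2 ^ c * card {f \<in> ?T. ?bad (merge b f g)} \<le> m * 2 ^ (n * m)"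
  have m_T: "merge b f g \<in> ?T" if "f \<in> ?T" "g \<in> ?T" for f g
    using that by (auto simp: PiE_dflt_def merge_def)
  have mm: "merge b (merge b f g) (merge b g f) = f" for f g :: "nat \<Rightarrow> bool list"
    by (auto simp: merge_def)
  have "bij_betw (\<lambda>(g, f). (merge b g f, merge b f g)) (SIGMA g:?T. {f \<in> ?T. ?bad (merge b f g)}) (?T \<times> ?X)"
    by (rule bij_betwI[where g = "\<lambda>(g, f). (merge b g f, merge b f g)"]) (auto simp: m_T mm)
  then have "card (SIGMA g:?T. {f \<in> ?T. ?bad (merge b f g)}) = card (?T \<times> ?X)"
    by (rule bij_betw_same_card)
  then have "2 ^ (n * m) * card ?X = (\<Sum>g\<in>?T. card {f \<in> ?T. ?bad (merge b f g)})"
    by (simp add: card_SigmaI finite_string_tuples card_cartesian_product card_string_tuples)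
  then have "2 ^ (n * m) * (2 ^ c * card ?X) = (\<Sum>g\<in>?T. 2 ^ c * card {f \<in> ?T. ?bad (merge b f g)})"
    by (simp only: mult.left_commute[of "2 ^ (n * m)"] sum_distrib_left)
  also have "\<dots> \<le> (\<Sum>g\<in>?T. m * 2 ^ (n * m))"
    using * by (intro sum_mono) blast
  also have "\<dots> = 2 ^ (n * m) * (m * 2 ^ (n * m))" by (simp add: card_string_tuples)
  finally show "2 ^ c * card ?X \<le> m * 2 ^ (n * m)" by simp
qed

section \<open>Union bound over the sign patterns\<close>

theorem theorem11:
  fixes m :: nat
  shows "\<exists>K::real. \<forall>D. provably_optimal D \<longrightarrow>
    (\<forall>c::nat. \<forall>\<^sub>F n in sequentially.
       measure_pmf.prob (Pi_pmf {..<m} [] (\<lambda>_. pmf_of_set {w :: bool list. length w = n}))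
         {x. PA_independent m (\<lambda>i. complexity_ge D (x i) (n - c))}
       \<ge> 1 - K * 2 powr (- real c))"
proof (intro exI[of _ "real (2 ^ m * m)"] allI impI)
  fix D c
  assume "provably_optimal D"
  \<comment> \<open>Patterns are taken as subsets of \<open>{..<m}\<close>, of which there are
    finitely many, so that one threshold for \<open>n\<close> serves them all.\<close>
  then have "\<forall>\<^sub>F n in sequentially. \<forall>P\<in>Pow {..<m}.
     2 ^ c * card {x \<in> string_tuples m n.
       \<not> consistent (PA \<union> signed D m (\<lambda>i. i \<in> P) (n - c) (\<lambda>i. string_code (x i)))} \<le> m * 2 ^ (n * m)"
    by (intro eventually_ball_finite ballI eventually_few_inconsistent) auto
  then show "\<forall>\<^sub>F n in sequentially.
       measure_pmf.prob (Pi_pmf {..<m} [] (\<lambda>_. pmf_of_set {w :: bool list. length w = n}))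
         {x. PA_independent m (\<lambda>i. complexity_ge D (x i) (n - c))}
       \<ge> 1 - real (2 ^ m * m) * 2 powr (- real c)"
  proof (rule eventually_mono)
    fix n
    let ?T = "string_tuples m n"
    let ?bad = "\<lambda>P. {x \<in> ?T. \<not> consistent (PA \<union> signed D m (\<lambda>i. i \<in> P) (n - c) (\<lambda>i. string_code (x i)))}"
    let ?G = "{x. PA_independent m (\<lambda>i. complexity_ge D (x i) (n - c))}"
    assume *: "\<forall>P\<in>Pow {..<m}. 2 ^ c * card (?bad P) \<le> m * 2 ^ (n * m)"
    have "?T - ?G \<subseteq> (\<Union>P\<in>Pow {..<m}. ?bad P)"
    proof
      fix x assume x: "x \<in> ?T - ?G"
      then obtain b :: "nat \<Rightarrow> bool" where b: "\<not> consistent (PA \<union> (\<lambda>i. if b i then complexity_ge D (x i) (n - c)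
          else \<^bold>\<not> complexity_ge D (x i) (n - c)) ` {..<m})"
        by (auto simp: PA_independent_def)
      also have "(\<lambda>i. if b i then complexity_ge D (x i) (n - c)
          else \<^bold>\<not> complexity_ge D (x i) (n - c)) ` {..<m} =
          signed D m (\<lambda>i. i \<in> {i. i < m \<and> b i}) (n - c) (\<lambda>i. string_code (x i))"
        unfolding signed_def complexity_ge_def by (intro image_cong) auto
      finally have "x \<in> ?bad {i. i < m \<and> b i}" using x by simp
      then show "x \<in> (\<Union>P\<in>Pow {..<m}. ?bad P)" by (rule UN_I[rotated]) auto
    qed
    then have "card (?T - ?G) \<le> card (\<Union>P\<in>Pow {..<m}. ?bad P)"
      by (intro card_mono finite_UN_I) (auto simp: finite_string_tuples)
    also have "\<dots> \<le> (\<Sum>P\<in>Pow {..<m}. card (?bad P))" by (intro card_UN_le) simp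
    finally have "2 ^ c * card (?T - ?G) \<le> (\<Sum>P\<in>Pow {..<m}. 2 ^ c * card (?bad P))"
      by (simp flip: sum_distrib_left)
    also have "\<dots> \<le> (\<Sum>P\<in>Pow {..<m}. m * 2 ^ (n * m))" using * by (intro sum_mono) blast
    also have "\<dots> = 2 ^ m * m * card ?T" by (simp add: card_Pow card_string_tuples)
    finally have "real (2 ^ c * card (?T - ?G)) \<le> real (2 ^ m * m * card ?T)" by (rule of_nat_mono)
    then have "real (card (?T - ?G)) \<le> real (2 ^ m * m) * 2 powr (- real c) * card ?T"
      by (simp add: powr_minus powr_realpow field_simps)
    moreover have "card (?T \<inter> ?G) + card (?T - ?G) = card ?T"
      using card_Int_Diff[OF finite_string_tuples] by simp
    then have "real (card (?T \<inter> ?G)) = card ?T - real (card (?T - ?G))" by linarith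
    moreover have pos: "card ?T > 0" by (simp add: card_string_tuples)
    ultimately have "1 - real (2 ^ m * m) * 2 powr (- real c) \<le> card (?T \<inter> ?G) / card ?T"
      by (simp add: field_simps)
    moreover have ne: "strings n \<noteq> {}"
      using card_strings[of n] by (metis card.empty power_not_zero zero_neq_numeral)
    \<comment> \<open>Independent uniform components amount to the uniform distribution on
      \<open>?T\<close>, so the probability is a quotient of cardinalities.\<close>
    have "Pi_pmf {..<m} [] (\<lambda>_. pmf_of_set (strings n)) = pmf_of_set ?T"
      by (intro Pi_pmf_of_set finite_strings finite_lessThan ne)
    moreover have "measure_pmf.prob (pmf_of_set ?T) ?G = card (?T \<inter> ?G) / card ?T"
      using pos by (intro measure_pmf_of_set finite_string_tuples) (metis card.empty less_irrefl)
    ultimately show "measure_pmf.prob (Pi_pmf {..<m} [] (\<lambda>_. pmf_of_set (strings n))) ?G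
       \<ge> 1 - real (2 ^ m * m) * 2 powr (- real c)"
      by simp
  qed
qed

end
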